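(* Let $(p_k)_{k\ge1}$ be the enumeration of the prime numbers in increasing order, and let $X_1,X_2,\ldots$ be independent random variables with $X_k\sim\mathrm{Geom}(1-1/p_k)$. Set $$S_n=\frac{1}{\log(p_n)}\sum_{k=1}^nX_k\log(p_k),$$ and let $D$ be a standard Dickman random variable. Then there is a universal constant $C$ such that for all $n\ge2$ $$d_{1,1}(S_n,D)\le\frac{C}{\log n}.$$ Moreover, the order is not improvable: there is a constant $c>0$ such that $d_{1,1}(S_n,D)\ge c/\log n$ for all sufficiently large $n$.
   Context: $X\sim\mathrm{Geom}(p)$ means $P(X=m)=(1-p)^mp$ for integers $m\ge0$. The standard Dickman distribution $\mathcal{D}$ is the unique law of a non-negative random variable $W$ satisfying $W=_dU(W+1)$, where $U\sim\mathcal{U}[0,1]$ is independent of $W$ and $=_d$ is equality in distribution. For $\alpha\ge 0$, $\mathrm{Lip}_\alpha$ is the set of real-valued functions $h$ with $|h(x)-h(y)|\le\alpha|x-y|$ for all $x,y$. $\mathcal{H}_{1,1}$ is the set of differentiable functions $h:[0,\infty)\to\mathbb{R}$ with $h\in\mathrm{Lip}_1$ and $h'\in\mathrm{Lip}_1$. For non-negative random variables $X,Y$, $d_{1,1}(X,Y)=\sup_{h\in\mathcal{H}_{1,1}}|E h(Y)-E h(X)|$. *)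

theory Defs
  imports "HOL-Probability.Probability" "HOL-Computational_Algebra.Primes"
    "HOL-Library.Infinite_Set"
begin

text \<open>Numbering starts at 1, whereas \<open>enumerate\<close> starts at 0: \<open>nth_prime 1 = 2\<close>,
  \<open>nth_prime 2 = 3\<close>, ...; the value at 0 is irrelevant.\<close>

definition nth_prime :: "nat \<Rightarrow> nat" where
  "nth_prime k = enumerate {p::nat. prime p} (k - 1)"

text \<open>\<open>geometric_pmf p\<close> has mass \<open>(1 - p) ^ m * p\<close> at \<open>m \<ge> 0\<close>.\<close>

definition indep_prime_geometric :: "'a measure \<Rightarrow> (nat \<Rightarrow> 'a \<Rightarrow> nat) \<Rightarrow> bool" where
  "indep_prime_geometric M X \<longleftrightarrow>
     prob_space M \<and>
     prob_space.indep_vars M (\<lambda>_. count_space UNIV) X {1..} \<and>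
     (\<forall>k\<ge>1. distr M (count_space UNIV) (X k)
              = measure_pmf (geometric_pmf (1 - 1 / real (nth_prime k))))"

definition prime_geometric_sum :: "(nat \<Rightarrow> 'a \<Rightarrow> nat) \<Rightarrow> nat \<Rightarrow> 'a \<Rightarrow> real" where
  "prime_geometric_sum X n \<omega> =
     1 / ln (real (nth_prime n)) * (\<Sum>k=1..n. real (X k \<omega>) * ln (real (nth_prime k)))"

text \<open>The fixed-point equation \<open>W =\<^sub>d U (W + 1)\<close> for the law \<open>\<mu>\<close> of \<open>W\<close>: independence of the
  uniform variable \<open>U\<close> and \<open>W\<close> means that the pair has the product law.\<close>

definition standard_dickman_law :: "real measure \<Rightarrow> bool" where
  "standard_dickman_law \<mu> \<longleftrightarrow>
     prob_space \<mu> \<and> sets \<mu> = sets borel \<and> (AE w in \<mu>. 0 \<le> w) \<and>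
     distr (uniform_measure lborel {0..1::real} \<Otimes>\<^sub>M \<mu>) borel (\<lambda>(u, w). u * (w + 1)) = \<mu>"

definition standard_dickman :: "'b measure \<Rightarrow> ('b \<Rightarrow> real) \<Rightarrow> bool" where
  "standard_dickman N D \<longleftrightarrow>
     prob_space N \<and> D \<in> borel_measurable N \<and> standard_dickman_law (distr N borel D)"

text \<open>A function on \<open>[0,\<infinity>)\<close> is represented by a total function whose values on negative
  arguments are unconstrained; the derivative at 0 is one-sided.\<close>

definition H11 :: "(real \<Rightarrow> real) set" where
  "H11 = {h. 1-lipschitz_on {0..} h \<and>
             (\<exists>h'. (\<forall>x\<ge>0. (h has_real_derivative h' x) (at x within {0..})) \<and>
                   1-lipschitz_on {0..} h')}"

text \<open>The distance depends only on the laws \<open>\<mu>\<close> of \<open>X\<close> and \<open>\<nu>\<close> of \<open>Y\<close>. As these live on \<open>[0,\<infinity>)\<close>,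
  \<open>E h(X)\<close> is the integral over \<open>{0..}\<close>; restricting it makes the arbitrary (possibly
  non-measurable) values of \<open>h\<close> on negative arguments harmless. The supremum is taken in the
  extended reals, so it is the true one even when unbounded. The definition is meant for laws
  with finite mean, for which every \<open>h\<close> in \<open>H11\<close> is integrable.\<close>

definition d11 :: "real measure \<Rightarrow> real measure \<Rightarrow> ereal" where
  "d11 \<mu> \<nu> = (SUP h\<in>H11. ereal \<bar>(LINT x:{0..}|\<nu>. h x) - (LINT x:{0..}|\<mu>. h x)\<bar>)"

end

theory Submission
  imports Defs "HOL-Number_Theory.Prime_Powers" "HOL-Real_Asymp.Real_Asymp"
begin

text \<open>
  Write \<open>L = ln p\<^sub>n\<close> and \<open>S\<close> for the normalised sum.

  Upper bound. For a geometric variable with \<open>P(X \<ge> 1) = 1/p\<close> and a bounded function \<open>\<phi>\<close>,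
  \<open>E (X \<phi>(X))\<close> is \<open>E \<phi>(X + 1) / p\<close> up to \<open>O(1/p\<^sup>2)\<close>. Summing over the independent summands gives
  \<open>E (S g(S)) = (\<Sum>k\<le>n. ln p\<^sub>k / (p\<^sub>k L) * E g(S + ln p\<^sub>k / L)) + O(1/L)\<close> (\<open>size_bias_S\<close>). By Mertens'
  first theorem the masses \<open>ln p\<^sub>k / (p\<^sub>k L)\<close> at the points \<open>ln p\<^sub>k / L\<close> are within \<open>O(1/L)\<close> of the
  uniform distribution, so \<open>E (S g(S)) = E g(S + U) + O(1/L)\<close> for bounded Lipschitz \<open>g\<close>
  (\<open>prime_sum_approx_integral\<close>). For the Dickman law this holds without error.

  To turn this into a bound on the distance, no Stein equation has to be solved. Let \<open>A h (x) = E h(U (x + 1))\<close>.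
  With \<open>g\<close> the derivative of \<open>x \<mapsto> E h(U x)\<close>, an elementary computation gives
  \<open>h(x) - A h (x) = x g(x) - E g(x + U)\<close> (\<open>dickman_generator\<close>), and \<open>g\<close> is bounded and Lipschitz for
  every test function \<open>h\<close>. Hence \<open>E h(S) = E A h (S) + O(1/L)\<close>, whereas \<open>E h(D) = E A h (D)\<close>. But
  \<open>2 A h\<close> is again a test function (\<open>contraction_in_H11\<close>). So the discrepancy of \<open>h\<close> is at most
  \<open>O(1/L)\<close> plus half the discrepancy of another test function, and since all discrepancies are
  bounded by the sum of the two means, iteration gives \<open>O(1/L)\<close> uniformly.

  Lower bound. The test function \<open>h(x) = x\<close> compares the means, \<open>E D = 1\<close> and
  \<open>E S = (\<Sum>k\<le>n. ln p\<^sub>k / (p\<^sub>k - 1)) / L\<close>. It is therefore enough that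
  \<open>(\<Sum>p\<le>x. ln p / (p - 1)) \<le> ln x - c\<close> for some \<open>c > 0\<close> and all large \<open>x\<close>
  (\<open>eventually_prime_weight_le\<close>). This is sharper than Mertens' theorem with its bounded error, but
  weaker than the prime number theorem: an elementary argument in the style of Chebyshev, with a
  suitable combination of the logarithms of factorials, suffices.
\<close>

section \<open>Chebyshev bounds\<close>

text \<open>Summing \<open>ln m = (\<Sum>d | d dvd m. mangoldt d)\<close> over \<open>m \<le> n\<close> counts \<open>mangoldt d\<close> once for every
  multiple of \<open>d\<close> up to \<open>n\<close>. This identity is the only source of information about primes below.\<close>

lemma ln_fact_eq_sum_mangoldt:
  "ln (fact n :: real) = (\<Sum>d=1..n. mangoldt d * real (n div d))"
proof (induction n)
  case (Suc n)
  have "ln (fact (Suc n) :: real) = ln (real (Suc n)) + ln (fact n)"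
    by (simp add: ln_mult del: of_nat_Suc)
  also have "ln (real (Suc n)) = (\<Sum>d | d dvd Suc n. mangoldt d)"
    using mangoldt_sum[of "Suc n", where ?'a = real] by simp
  also have "\<dots> = (\<Sum>d=1..Suc n. if d dvd Suc n then mangoldt d else 0)"
    by (subst sum.inter_filter [symmetric])
       (auto intro!: sum.cong dest: dvd_imp_le intro: Nat.gr0I simp: Suc_le_eq)
  also have "ln (fact n :: real) = (\<Sum>d=1..Suc n. mangoldt d * real (n div d))"
    by (simp add: Suc.IH)
  also have "(\<Sum>d=1..Suc n. if d dvd Suc n then mangoldt d else 0) +
      (\<Sum>d=1..Suc n. mangoldt d * real (n div d)) =
      (\<Sum>d=1..Suc n. mangoldt d * real (Suc n div d))"
    unfolding sum.distrib [symmetric]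
    by (intro sum.cong) (auto simp: div_Suc dvd_eq_mod_eq_0 algebra_simps)
  finally show ?case .
qed simp

lemma ln_fact_bounds:
  assumes "n \<ge> 1"
  shows "real n * ln n - n \<le> ln (fact n)" and "ln (fact n) \<le> real n * ln n - n + ln n + 1"
  using assms
proof (induction n rule: dec_induct)
  case (step n)
  have n: "real n > 0" using step by simp
  have eq: "ln (fact (Suc n) :: real) = ln (1 + real n) + ln (fact n)"
    by (simp add: ln_mult add.commute flip: of_nat_Suc)
  have sp: "ln (1 + real n) = ln n + ln (1 + 1 / real n)"
  proof -
    have "1 + real n = real n * (1 + 1 / real n)" using n by (simp add: field_simps)
    thus ?thesis using n by (subst ln_mult_pos [symmetric]) (auto simp: add_pos_pos)
  qed
  have u: "ln (1 + 1 / real n) \<le> 1 / real n"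
    by (rule ln_add_one_self_le_self) (use n in simp)
  have l: "ln (1 + 1 / real n) \<ge> 1 / (1 + real n)"
  proof -
    have "ln (real n / (1 + real n)) \<le> real n / (1 + real n) - 1"
      using n by (intro ln_le_minus_one) auto
    also have "\<dots> = - (1 / (1 + real n))" using n by (simp add: field_simps)
    finally have "ln (real n) - ln (1 + real n) \<le> - (1 / (1 + real n))"
      using n by (simp add: ln_div)
    thus ?thesis using sp by linarith
  qed
  have u': "real n * ln (1 + 1 / real n) \<le> 1" 
    using mult_left_mono[OF u, of "real n"] n by simp
  have l': "(1 + real n) * ln (1 + 1 / real n) \<ge> 1"
    using mult_left_mono[OF l, of "1 + real n"] n by simp
  case 1
  show ?case using step(3) u' unfolding eq of_nat_Suc
    by (simp add: sp algebra_simps)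
  case 2
  show ?case using step(4) l' unfolding eq of_nat_Suc
    by (simp add: sp algebra_simps)
qed simp_all

definition chebyshev_psi :: "nat \<Rightarrow> real" where
  "chebyshev_psi n = (\<Sum>d=1..n. mangoldt d)"

text \<open>Chebyshev's device: \<open>\<lfloor>z\<rfloor> - 2 \<lfloor>z / 2\<rfloor>\<close> is never negative, and equals 1 for \<open>1 \<le> z < 2\<close>. Hence
  \<open>ln n! - 2 ln \<lfloor>n / 2\<rfloor>!\<close> dominates the contribution of \<open>n / 2 < d \<le> n\<close> to \<open>chebyshev_psi n\<close>.\<close>

lemma chebyshev_psi_step: "chebyshev_psi n \<le> chebyshev_psi (n div 2) + ln (fact n) - 2 * ln (fact (n div 2))"
proof -
  have *: "(\<Sum>d=1..n div k. mangoldt d * real (n div k div d)) =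
      (\<Sum>d=1..n. mangoldt d * real (n div d div k))" if "k > 0" for k
    using that by (intro sum.mono_neutral_cong_left)
      (auto simp: div_mult2_eq [symmetric] mult.commute div_le_dividend not_le
        intro: order_trans[OF _ div_le_dividend]  simp: less_mult_imp_div_less div_less_iff_less_mult)
  have "chebyshev_psi n - chebyshev_psi (n div 2) = (\<Sum>d=1..n. mangoldt d * (if d \<le> n div 2 then 0 else 1))"
  proof -
    have "chebyshev_psi (n div 2) = (\<Sum>d=1..n. mangoldt d * (if d \<le> n div 2 then 1 else 0))"
      unfolding chebyshev_psi_def by (intro sum.mono_neutral_cong_left) auto
    thus ?thesis unfolding chebyshev_psi_def
      by (simp add: sum_subtractf [symmetric]) (intro sum.cong, auto)
  qed
  also have "\<dots> \<le> (\<Sum>d=1..n. mangoldt d * (real (n div d) - 2 * real (n div d div 2)))"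
  proof (intro sum_mono mult_left_mono mangoldt_nonneg)
    fix d assume d: "d \<in> {1..n}"
    have "n div d \<ge> 1" using d by (simp add: div_greater_zero_iff Suc_le_eq)
    moreover have "n div d < 2" if "d > n div 2"
      using that d by (subst div_less_iff_less_mult) auto
    moreover have "2 * (n div d div 2) \<le> n div d" by simp
    ultimately show "(if d \<le> n div 2 then 0 else 1) \<le> real (n div d) - 2 * real (n div d div 2)"
      by auto
  qed
  also have "\<dots> = ln (fact n) - 2 * ln (fact (n div 2))"
    unfolding ln_fact_eq_sum_mangoldt *[OF zero_less_numeral] sum_distrib_left
      sum_subtractf [symmetric]
    by (intro sum.cong) (auto simp: algebra_simps)
  finally show ?thesis by simp
qed

lemma fact_le_pow2_mult_fact_half: "fact n \<le> (2 ^ n * (n + 1) * fact (n div 2) ^ 2 :: nat)"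
proof -
  have *: "fact (2 * m) \<le> (2 ^ (2 * m) * fact m ^ 2 :: nat)" for m
  proof -
    have "fact (2 * m) = fact m ^ 2 * (2 * m choose m)"
      using binomial_fact_lemma[of m "2 * m"] by (simp add: power2_eq_square)
    also have "\<dots> \<le> fact m ^ 2 * 2 ^ (2 * m)"
      by (intro mult_left_mono binomial_le_pow2) auto
    finally show ?thesis by (simp add: mult.commute)
  qed
  show ?thesis
  proof (cases "even n")
    case True
    then obtain m where n: "n = 2 * m" by blast
    have "fact n \<le> (2 ^ n * fact m ^ 2 :: nat) * 1" using *[of m] n by simp
    also have "\<dots> \<le> 2 ^ n * fact m ^ 2 * (n + 1)" by (intro mult_left_mono) auto
    also have "m = n div 2" using n by simp
    finally show ?thesis by (simp only: ac_simps)
  next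
    case False
    then obtain m where n: "n = 2 * m + 1" by (elim oddE)
    have "fact n = n * (fact (2 * m) :: nat)" using n by simp
    also have "\<dots> \<le> n * (2 ^ (2 * m) * fact m ^ 2)" by (intro mult_left_mono *) auto
    also have "\<dots> \<le> (n + 1) * (2 ^ n * fact m ^ 2)"
      by (intro mult_mono) (auto simp: n)
    also have "m = n div 2" using n by simp
    finally show ?thesis by (simp only: ac_simps)
  qed
qed

lemma ln_add_one_le_scaled: "n \<ge> 1 \<Longrightarrow> ln (real n + 1) \<le> 0.8 * n"
proof -
  assume n: "n \<ge> 1"
  have "ln (real n + 1) = ln 2 + ln ((real n + 1) / 2)"
    by (subst ln_mult_pos [symmetric]) auto
  also have "ln ((real n + 1) / 2) \<le> (real n + 1) / 2 - 1"
    by (intro ln_le_minus_one) auto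
  also have "ln (2::real) \<le> 25 / 36" by (rule ln2_le_25_over_36)
  finally have "36 * ln (real n + 1) \<le> 25 + 18 * real n - 18" by (simp add: field_simps)
  moreover have "real n \<ge> 1" using n by simp
  ultimately have "5 * ln (real n + 1) \<le> 4 * real n" by linarith
  thus ?thesis by simp
qed

text \<open>The halving step costs about \<open>n ln 2\<close>, so repeating it costs about \<open>2 n ln 2\<close>; the constant 3
  leaves room for the logarithmic error terms and makes the induction work from \<open>n = 1\<close>.\<close>

lemma chebyshev_psi_le: "chebyshev_psi n \<le> 3 * real n"
proof (induction n rule: less_induct)
  case (less n)
  show ?case
  proof (cases "n = 0")
    case False
    have "chebyshev_psi n \<le> chebyshev_psi (n div 2) + (ln (fact n) - 2 * ln (fact (n div 2)))"
      using chebyshev_psi_step[of n] by simp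
    also have "ln (fact n) - 2 * ln (fact (n div 2)) \<le> real n * ln 2 + ln (real n + 1)"
    proof -
      have le: "real (fact n) \<le> real (2 ^ n * (n + 1) * fact (n div 2) ^ 2)"
        using fact_le_pow2_mult_fact_half[of n] by (rule of_nat_mono)
      have "real n + 1 > 0" by simp
      hence pos: "real n + 1 > 0" "0 < 2 ^ n * (real n + 1) * fact (n div 2) ^ 2"
        by (simp_all only: mult_pos_pos zero_less_power zero_less_numeral fact_gt_zero)
      note le
      hence "(fact n :: real) \<le> 2 ^ n * (real n + 1) * fact (n div 2) ^ 2"
        by (simp only: of_nat_mult of_nat_add of_nat_power of_nat_fact of_nat_1 of_nat_numeral)
      hence "ln (fact n :: real) \<le> ln (2 ^ n * (real n + 1) * fact (n div 2) ^ 2)"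
        using pos by (subst ln_le_cancel_iff) (assumption | rule fact_gt_zero)+
      also have "\<dots> = ln (2 ^ n) + ln (real n + 1) + ln (fact (n div 2) ^ 2)"
        using pos by (simp only: ln_mult_pos mult_pos_pos zero_less_power zero_less_numeral fact_gt_zero)
      also have "\<dots> = real n * ln 2 + ln (real n + 1) + 2 * ln (fact (n div 2))"
        by (simp only: ln_realpow zero_less_numeral fact_gt_zero of_nat_numeral)
      finally show ?thesis by simp
    qed
    also have "chebyshev_psi (n div 2) \<le> 3 * real (n div 2)"
      using False by (intro less) auto
    also have "real (n div 2) \<le> real n / 2" by linarith
    also have "real n * ln 2 \<le> real n * (25 / 36)"
      by (intro mult_left_mono ln2_le_25_over_36) auto
    also have "ln (real n + 1) \<le> 0.8 * n" using False by (intro ln_add_one_le_scaled) auto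
    finally show ?thesis by simp
  qed (simp add: chebyshev_psi_def)
qed

definition mangoldt_weight :: "nat \<Rightarrow> real" where
  "mangoldt_weight n = (\<Sum>d=1..n. mangoldt d / real d)"

text \<open>Replacing \<open>n div d\<close> by \<open>n / d\<close> in the formula for \<open>ln n!\<close> turns the right-hand side into
  \<open>n * mangoldt_weight n\<close>. Everything known about \<open>mangoldt_weight\<close> comes from bounds on the
  fractional parts that appear as the error.\<close>

lemma mangoldt_weight_eq:
  "real n * mangoldt_weight n =
     ln (fact n) + (\<Sum>d=1..n. mangoldt d * (real n / real d - real (n div d)))"
  unfolding mangoldt_weight_def ln_fact_eq_sum_mangoldt sum_distrib_left sum.distrib [symmetric]
  by (intro sum.cong) (auto simp: algebra_simps)

lemma frac_div: 
  assumes "d > 0" 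
  shows "0 \<le> real n / real d - real (n div d)" "real n / real d - real (n div d) \<le> 1"
proof -
  define q r where "q = n div d" and "r = n mod d"
  have "n = q * d + r" "r \<le> d" using assms by (simp_all add: q_def r_def less_imp_le)
  hence "real n = real q * real d + real r" "real r \<le> real d" by simp_all
  thus "0 \<le> real n / real d - real (n div d)" "real n / real d - real (n div d) \<le> 1"
    using assms unfolding q_def [symmetric] by (simp_all add: field_simps)
qed

lemma mangoldt_weight_bounds:
  assumes "n \<ge> 1"
  shows "ln n - 1 \<le> mangoldt_weight n" "mangoldt_weight n \<le> ln n + 3"
proof -
  have n: "real n > 0" using assms by simp
  have 1: "0 \<le> (\<Sum>d=1..n. mangoldt d * (real n / real d - real (n div d)))"
    by (intro sum_nonneg mult_nonneg_nonneg mangoldt_nonneg frac_div) auto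
  have "(\<Sum>d=1..n. mangoldt d * (real n / real d - real (n div d))) \<le> (\<Sum>d=1..n. mangoldt d * 1)"
    by (intro sum_mono mult_left_mono mangoldt_nonneg frac_div) auto
  also have "\<dots> \<le> 3 * real n" using chebyshev_psi_le[of n] by (simp add: chebyshev_psi_def)
  finally have 2: "(\<Sum>d=1..n. mangoldt d * (real n / real d - real (n div d))) \<le> 3 * real n" .
  have "real n * (ln n - 1) \<le> real n * mangoldt_weight n"
    using 1 ln_fact_bounds(1)[OF assms] by (simp add: mangoldt_weight_eq algebra_simps)
  thus "ln n - 1 \<le> mangoldt_weight n" using n by simp
  have "ln (real n) \<le> real n - 1" using n by (intro ln_le_minus_one)
  hence "real n * mangoldt_weight n \<le> real n * (ln n + 3)"
    using 2 ln_fact_bounds(2)[OF assms] n by (simp add: mangoldt_weight_eq algebra_simps)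
  thus "mangoldt_weight n \<le> ln n + 3" using n by simp
qed

section \<open>An upper bound for the weighted sum over prime powers\<close>

text \<open>The coefficients solve a small linear program. The aim is an upper bound for
  \<open>(\<Sum>d\<le>x. mangoldt d * frac (x / d))\<close> that is smaller than \<open>x\<close> by a constant factor; with
  \<open>z = 2 x div d\<close>, twice the fractional part is at most 1 or 2 according to the parity of \<open>z\<close>. A
  combination of the \<open>z div k\<close> that dominates this step function can be summed against
  \<open>mangoldt\<close>, because each \<open>z div k\<close> yields the logarithm of a factorial. Working with \<open>2 x\<close>
  rather than \<open>x\<close> is essential: a bound that depends only on \<open>x div d\<close> cannot do better than 1 for
  every fractional part, which gives \<open>x\<close> itself. The coefficients divided by \<open>k\<close> add up to 0, so
  that the combination is periodic and the main terms \<open>n ln n\<close> cancel.\<close>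

definition floor_comb :: "nat \<Rightarrow> int" where
  "floor_comb z = int (z div 2) + int (z div 3) + int (z div 5)
       - 2 * int (z div 4) - 2 * int (z div 6) - 2 * int (z div 15)
       - int (z div 30) - 2 * int (z div 60)"

lemma floor_comb_periodic: "floor_comb z = floor_comb (z mod 60)"
proof -
  define q r where "q = z div 60" and "r = z mod 60"
  have z: "z = q * 60 + r" unfolding q_def r_def by simp
  have *: "z div k = q * c + r div k" if "60 = c * k" "k > 0" for k c
  proof -
    have "z = r + (q * c) * k" unfolding z that(1) by (simp add: mult.assoc)
    thus ?thesis using that(2) by simp
  qed
  have "z div 2 = q * 30 + r div 2" "z div 3 = q * 20 + r div 3" "z div 4 = q * 15 + r div 4"
    "z div 5 = q * 12 + r div 5" "z div 6 = q * 10 + r div 6" "z div 15 = q * 4 + r div 15"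
    "z div 30 = q * 2 + r div 30" "z div 60 = q * 1 + r div 60"
    by (rule *; simp)+
  hence "floor_comb z = floor_comb r" unfolding floor_comb_def by simp
  thus ?thesis by (simp add: r_def)
qed

text \<open>The step function is dominated on the first period, and later up to an error of 2. That error
  only concerns \<open>d \<le> 2 x / 60\<close>, where the Chebyshev bound is cheap enough.\<close>

lemma floor_comb_ge:
  "floor_comb z \<ge> (if z < 2 then 0 else if even z then 1 else 2) - (if z \<ge> 60 then 2 else 0)"
proof -
  have "list_all (\<lambda>z. floor_comb z \<ge> (if z < 2 then 0 else if even z then 1 else 2)) [0..<60]"
    unfolding floor_comb_def by (simp add: upt_rec)
  hence *: "\<forall>z<60. floor_comb z \<ge> (if z < 2 then 0 else if even z then 1 else 2)"
    by (simp only: list_all_iff set_upt atLeastLessThan_iff Ball_def le0 simp_thms)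
  show ?thesis
  proof (cases "z < 60")
    case True
    thus ?thesis using * by simp
  next
    case False
    have "z mod 60 < 60" by simp
    hence "floor_comb (z mod 60) \<ge> (if z mod 60 < 2 then 0 else if even (z mod 60) then 1 else 2)"
      using * by blast
    hence "floor_comb z \<ge> 0" by (subst floor_comb_periodic) (simp split: if_splits)
    thus ?thesis using False by simp
  qed
qed

lemma sum_mangoldt_div_div:
  assumes "k > 0"
  shows "(\<Sum>d=1..n. mangoldt d * real (n div d div k)) = ln (fact (n div k))"
  unfolding ln_fact_eq_sum_mangoldt using assms
  by (intro sum.mono_neutral_cong_right)
     (auto simp: div_mult2_eq [symmetric] mult.commute not_le less_mult_imp_div_less 
        div_less_iff_less_mult intro: order_trans[OF _ div_le_dividend])

text \<open>The parity of \<open>2 n div d\<close> tells in which half of the unit interval the fractional part of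
  \<open>n / d\<close> lies.\<close>

lemma double_frac_le:
  assumes "d > 0"
  shows "2 * (real n / real d - real (n div d)) \<le> (if even (2 * n div d) then 1 else 2)"
proof (cases "even (2 * n div d)")
  case True
  define q r where "q = n div d" and "r = n mod d"
  have n: "n = q * d + r" "r < d" using assms by (simp_all add: q_def r_def)
  have "2 * n div d = (2 * r + (2 * q) * d) div d" by (simp add: n(1) algebra_simps)
  also have "\<dots> = 2 * q + 2 * r div d" using assms by simp
  finally have "even (2 * r div d)" using True by simp
  moreover have "2 * r div d < 2" using n(2) assms by (subst div_less_iff_less_mult) auto
  ultimately have "2 * r div d = 0" by (cases "2 * r div d = 1") auto
  hence "2 * r < d" using assms by (simp add: div_eq_0_iff)
  hence "2 * real r \<le> real d" by linarith
  moreover have "real n = real q * real d + real r" using n(1) by simp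
  ultimately have "2 * (real n / real d - real q) \<le> 1" using assms by (simp add: field_simps)
  thus ?thesis using True by (simp add: q_def)
qed (use frac_div(2)[OF assms, of n] in simp)

text \<open>The sum over \<open>d \<le> n\<close> may be extended to \<open>d \<le> 2 n\<close>, because the dominating combination is not
  negative; the extension completes the formulas for the logarithms of the factorials.\<close>

lemma frac_weight_le:
  "2 * (\<Sum>d=1..n. mangoldt d * (real n / real d - real (n div d))) \<le>
     (ln (fact (2 * n div 2)) + ln (fact (2 * n div 3)) + ln (fact (2 * n div 5))
       - 2 * ln (fact (2 * n div 4)) - 2 * ln (fact (2 * n div 6)) - 2 * ln (fact (2 * n div 15))
       - ln (fact (2 * n div 30)) - 2 * ln (fact (2 * n div 60))) + 2 * chebyshev_psi (2 * n div 60)"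
proof -
  define N where "N = 2 * n"
  define w where "w = (\<lambda>z::nat. real_of_int (floor_comb z) + (if z \<ge> 60 then 2 else 0))"
  have w: "w z \<ge> (if z < 2 then 0 else if even z then 1 else 2)" for z
  proof -
    have "real_of_int (floor_comb z) \<ge>
        real_of_int ((if z < 2 then 0 else if even z then 1 else 2) - (if z \<ge> 60 then 2 else 0))"
      using floor_comb_ge[of z] by (simp only: of_int_le_iff)
    thus ?thesis unfolding w_def by (auto split: if_splits)
  qed
  have "2 * (\<Sum>d=1..n. mangoldt d * (real n / real d - real (n div d))) =
      (\<Sum>d=1..n. mangoldt d * (2 * (real n / real d - real (n div d))))"
    by (simp add: sum_distrib_left algebra_simps)
  also have "\<dots> \<le> (\<Sum>d=1..n. mangoldt d * w (N div d))"
  proof (intro sum_mono mult_left_mono mangoldt_nonneg)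
    fix d assume d: "d \<in> {1..n}"
    have "N div d \<ge> 2" using d by (subst less_eq_div_iff_mult_less_eq) (auto simp: N_def)
    thus "2 * (real n / real d - real (n div d)) \<le> w (N div d)"
      using double_frac_le[of d n] w[of "N div d"] d unfolding N_def
      by (auto split: if_splits)
  qed
  also have "\<dots> \<le> (\<Sum>d=1..N. mangoldt d * w (N div d))"
  proof (intro sum_mono2 mult_nonneg_nonneg mangoldt_nonneg)
    show "w z \<ge> 0" for z using w[of z] by (auto split: if_splits)
  qed (auto simp: N_def)
  also have "\<dots> = (\<Sum>d=1..N. mangoldt d * real_of_int (floor_comb (N div d))) +
                  (\<Sum>d=1..N. mangoldt d * (if N div d \<ge> 60 then 2 else 0))"
    by (simp add: w_def sum.distrib algebra_simps)
  also have "(\<Sum>d=1..N. mangoldt d * (if N div d \<ge> 60 then 2 else 0)) = 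
      (\<Sum>d=1..N div 60. mangoldt d * 2)"
    by (intro sum.mono_neutral_cong_right)
       (auto simp: less_eq_div_iff_mult_less_eq mult.commute intro: order_trans[OF _ div_le_dividend])
  also have "\<dots> = 2 * chebyshev_psi (N div 60)"
    by (simp add: chebyshev_psi_def sum_distrib_left mult.commute)
  also have "(\<Sum>d=1..N. mangoldt d * real_of_int (floor_comb (N div d))) =
      (\<Sum>d=1..N. mangoldt d * real (N div d div 2)) + (\<Sum>d=1..N. mangoldt d * real (N div d div 3))
     + (\<Sum>d=1..N. mangoldt d * real (N div d div 5)) - 2 * (\<Sum>d=1..N. mangoldt d * real (N div d div 4))
     - 2 * (\<Sum>d=1..N. mangoldt d * real (N div d div 6)) - 2 * (\<Sum>d=1..N. mangoldt d * real (N div d div 15))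
     - (\<Sum>d=1..N. mangoldt d * real (N div d div 30)) - 2 * (\<Sum>d=1..N. mangoldt d * real (N div d div 60))"
    unfolding sum_distrib_left sum.distrib [symmetric] sum_subtractf [symmetric]
    by (intro sum.cong refl) (simp add: floor_comb_def algebra_simps)
  also have "\<dots> = ln (fact (N div 2)) + ln (fact (N div 3)) + ln (fact (N div 5))
       - 2 * ln (fact (N div 4)) - 2 * ln (fact (N div 6)) - 2 * ln (fact (N div 15))
       - ln (fact (N div 30)) - 2 * ln (fact (N div 60))"
    by (simp only: sum_mangoldt_div_div zero_less_numeral)
  finally show ?thesis unfolding N_def .
qed

lemma ln_fact_div_approx:
  assumes "k > 0" "k \<le> n"
  shows "\<bar>ln (fact (n div k)) - (real n / k * ln (real n / k) - real n / k)\<bar> \<le> ln n + 1"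
proof -
  define m y where "m = n div k" and "y = real n / real k"
  have m: "m \<ge> 1" using assms by (simp add: m_def Suc_le_eq div_greater_zero_iff)
  have my: "real m \<le> y" "y \<le> real m + 1"
    using frac_div[of k n] assms by (auto simp: m_def y_def)
  have pos: "real m > 0" "y > 0" "real m \<ge> 1" using m my by auto
  have yn: "y \<le> n" using assms by (simp add: y_def field_simps)
  have ln_nn: "ln y \<ge> 0" "ln y \<le> ln n" "ln m \<ge> 0" "ln m \<le> ln y" using pos my yn by auto
  have a: "y * ln m \<le> y * ln y + m - y"
  proof -
    have "ln (m / y) \<le> m / y - 1" using pos by (intro ln_le_minus_one) auto
    hence "y * (ln m - ln y) \<le> y * (m / y - 1)" using pos by (intro mult_left_mono) (auto simp: ln_div)
    thus ?thesis using pos by (simp add: algebra_simps)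
  qed
  have b: "m * ln y \<le> m * ln m + y - m"
  proof -
    have "ln (y / m) \<le> y / m - 1" using pos by (intro ln_le_minus_one) auto
    hence "m * (ln y - ln m) \<le> m * (y / m - 1)" using pos by (intro mult_left_mono) (auto simp: ln_div)
    thus ?thesis using pos by (simp add: algebra_simps)
  qed
  have "m * ln m \<le> y * ln m" using my ln_nn by (intro mult_right_mono) auto
  hence 1: "m * ln m - m \<le> y * ln y - y" using a by linarith
  have "(y - m) * ln y \<le> 1 * ln y" using my ln_nn by (intro mult_right_mono) auto
  hence 2: "y * ln y - y \<le> m * ln m - m + ln y" using b by (simp add: algebra_simps)
  have "\<bar>ln (fact m) - (y * ln y - y)\<bar> \<le> ln n + 1"
    using ln_fact_bounds[OF m] 1 2 ln_nn by linarith
  thus ?thesis by (simp add: m_def y_def)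
qed

lemma ln_3_le: "ln (3::real) \<le> 1.105"
proof -
  have "2 * ln (3::real) = ln (3 ^ 2)" by (subst ln_realpow) auto
  also have "(3::real) ^ 2 = 2 ^ 3 * (9 / 8)" by simp
  also have "ln (2 ^ 3 * (9 / 8 :: real)) = 3 * ln 2 + ln (9 / 8)"
    using ln_mult_pos[of "2 ^ 3" "9 / 8 :: real"] ln_realpow[of "2::real" 3] by simp
  also have "ln (9 / 8 :: real) \<le> 1 / 8" using ln_le_minus_one[of "9 / 8 :: real"] by simp
  finally show ?thesis using ln2_le_25_over_36 by simp
qed

text \<open>The combination of the factorials contributes \<open>2 n (14/15 ln 2 + 1/5 ln 3)\<close> to twice the sum (the
  terms with \<open>ln 5\<close> cancel) and the Chebyshev bound for \<open>d \<le> 2 n / 60\<close> contributes \<open>2 n / 10\<close>;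
  together this is less than \<open>2 n * 0.97\<close>.\<close>

lemma frac_weight_asymp:
  assumes "n \<ge> 30"
  shows "(\<Sum>d=1..n. mangoldt d * (real n / real d - real (n div d))) \<le> 
           0.97 * n + 6 * (ln (2 * real n) + 1)"
proof -
  define N where "N = 2 * n"
  have N: "N \<ge> 60" using assms by (simp add: N_def)
  define g where "g = (\<lambda>k::real. N / k * ln (N / k) - N / k)"
  have g: "\<bar>ln (fact (N div k)) - g k\<bar> \<le> ln N + 1" if "k > 0" "k \<le> 60" for k :: nat
    using ln_fact_div_approx[of k N] N that by (simp add: g_def)
  have gk: "g k = N / k * (ln N - ln k - 1)" if "k > 0" for k
    using that N unfolding g_def by (subst ln_div) (auto simp: field_simps)
  have l: "ln (4::real) = 2 * ln 2" "ln (6::real) = ln 2 + ln 3" "ln (15::real) = ln 3 + ln 5"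
    "ln (30::real) = ln 2 + ln 3 + ln 5" "ln (60::real) = 2 * ln 2 + ln 3 + ln 5"
    using ln_mult_pos[of 2 "2::real"] ln_mult_pos[of 2 "3::real"] ln_mult_pos[of 3 "5::real"]
      ln_mult_pos[of 2 "15::real"] ln_mult_pos[of 4 "15::real"] by simp_all
  have main: "g 2 + g 3 + g 5 - 2 * g 4 - 2 * g 6 - 2 * g 15 - g 30 - 2 * g 60 =
      N * (14 / 15 * ln 2 + ln 3 / 5)"
    by (simp add: gk l field_simps)
  have "2 * (\<Sum>d=1..n. mangoldt d * (real n / real d - real (n div d))) \<le>
     (ln (fact (N div 2)) + ln (fact (N div 3)) + ln (fact (N div 5))
       - 2 * ln (fact (N div 4)) - 2 * ln (fact (N div 6)) - 2 * ln (fact (N div 15))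
       - ln (fact (N div 30)) - 2 * ln (fact (N div 60))) + 2 * chebyshev_psi (N div 60)"
    unfolding N_def by (rule frac_weight_le)
  also have "chebyshev_psi (N div 60) \<le> 3 * real (N div 60)" by (rule chebyshev_psi_le)
  also have "real (N div 60) \<le> real N / 60" using frac_div(1)[of 60 N] by simp
  also have "ln (fact (N div 2)) + ln (fact (N div 3)) + ln (fact (N div 5))
       - 2 * ln (fact (N div 4)) - 2 * ln (fact (N div 6)) - 2 * ln (fact (N div 15))
       - ln (fact (N div 30)) - 2 * ln (fact (N div 60)) \<le>
      (g 2 + g 3 + g 5 - 2 * g 4 - 2 * g 6 - 2 * g 15 - g 30 - 2 * g 60) + 12 * (ln N + 1)"
    using g[of 2] g[of 3] g[of 4] g[of 5] g[of 6] g[of 15] g[of 30] g[of 60]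
    unfolding of_nat_numeral by (simp add: abs_le_iff)
  also note main
  also have "N * (14 / 15 * ln 2 + ln 3 / 5) \<le> N * (14 / 15 * (25 / 36) + 1.105 / 5)"
    using ln2_le_25_over_36 ln_3_le by (intro mult_left_mono add_mono) auto
  finally show ?thesis by (simp add: N_def)
qed

text \<open>By Stirling's formula \<open>ln n!\<close> is \<open>n ln n - n\<close> up to a logarithm, and the fractional parts give
  back at most \<open>0.97 n\<close>. The true value of the difference to \<open>ln n\<close> tends to minus Euler's constant,
  which has the strength of the prime number theorem; a negative upper bound is all that is used.\<close>

lemma eventually_mangoldt_weight_le: "eventually (\<lambda>n. mangoldt_weight n \<le> ln n - 0.02) sequentially"
proof -
  have "eventually (\<lambda>n. ln (real n) + 1 + 6 * (ln (2 * real n) + 1) \<le> 0.01 * real n) sequentially"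
    by real_asymp
  thus ?thesis using eventually_ge_at_top[of 30]
  proof eventually_elim
    case (elim n)
    have n: "real n > 0" using elim by simp
    have "real n * mangoldt_weight n \<le> 
       (real n * ln n - n + ln n + 1) + (0.97 * n + 6 * (ln (2 * real n) + 1))"
      unfolding mangoldt_weight_eq using elim by (intro add_mono ln_fact_bounds frac_weight_asymp) auto
    also have "\<dots> \<le> real n * (ln n - 0.02)" using elim by (simp add: algebra_simps)
    finally show ?case using n by simp
  qed
qed

section \<open>Sums over primes\<close>

definition prime_weight :: "nat \<Rightarrow> real" where
  "prime_weight n = (\<Sum>p | prime p \<and> p \<le> n. ln p / (real p - 1))"

text \<open>Sorting the prime powers \<open>p ^ Suc k \<le> n\<close> by their prime.\<close>

lemma mangoldt_weight_eq_prime_powers: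
  "mangoldt_weight n = (\<Sum>p | prime p \<and> p \<le> n. \<Sum>k | p ^ Suc k \<le> n. ln p / real p ^ Suc k)"
proof -
  let ?S = "Sigma {p. prime p \<and> p \<le> n} (\<lambda>p. {k. p ^ Suc k \<le> n})"
  have fin: "finite {k. p ^ Suc k \<le> n}" if "prime p" for p
  proof (rule finite_subset)
    show "{k. p ^ Suc k \<le> n} \<subseteq> {..n}"
    proof safe
      fix k assume "p ^ Suc k \<le> n"
      moreover have "p > Suc 0" using that prime_gt_1_nat by simp
      hence "Suc k < p ^ Suc k" by (rule power_gt_expt)
      ultimately show "k \<le> n" by simp
    qed
  qed auto
  have "mangoldt_weight n = (\<Sum>d | primepow d \<and> d \<le> n. mangoldt d / real d)"
    unfolding mangoldt_weight_def
    by (intro sum.mono_neutral_cong_right)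
       (auto simp: mangoldt_def Suc_le_eq intro: primepow_gt_0_nat)
  also have "\<dots> = (\<Sum>(p,k)\<in>?S. ln p / real p ^ Suc k)"
  proof (rule sum.reindex_bij_betw [where h = "\<lambda>(p, k). p ^ Suc k", symmetric, THEN trans])
    have "bij_betw (\<lambda>(p,k). p ^ Suc k :: nat) ?S ((\<lambda>(p,k). p ^ Suc k) ` ?S)"
      by (rule inj_on_imp_bij_betw) 
        (rule inj_on_subset[OF bij_betw_imp_inj_on[OF bij_betw_primepows]], auto)
    also have "(\<lambda>(p,k). p ^ Suc k) ` ?S = {d::nat. primepow d \<and> d \<le> n}"
    proof (intro equalityI subsetI)
      fix d assume "d \<in> {d::nat. primepow d \<and> d \<le> n}"
      then obtain p k where pk: "prime p" "k > 0" "d = p ^ k" "d \<le> n"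
        by (auto simp: primepow_def)
      moreover from pk have "p ^ Suc (k - 1) = d" by simp
      moreover from pk have "p \<le> p ^ k" 
        by (intro self_le_power) (auto dest: prime_gt_0_nat)
      ultimately show "d \<in> (\<lambda>(p,k). p ^ Suc k) ` ?S"
        by (intro image_eqI[of _ _ "(p, k - 1)"]) (auto simp del: power_Suc)
      qed (auto simp del: power_Suc)
    finally show "bij_betw (\<lambda>(p,k). p ^ Suc k :: nat) ?S {d. primepow d \<and> d \<le> n}" .
  qed (auto intro!: sum.cong simp del: power_Suc)
  also have "\<dots> = (\<Sum>p | prime p \<and> p \<le> n. \<Sum>k | p ^ Suc k \<le> n. ln p / real p ^ Suc k)"
    by (rule sum.Sigma [symmetric]) (use fin in auto)
  finally show ?thesis .
qed

text \<open>The missing powers of \<open>p\<close> form a geometric series. It is bounded both by its first possible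
  exponent, which is at least 2, and by the fact that its first term is smaller than \<open>1 / n\<close>. The
  first bound is summable over all primes, the second tends to 0 for each of them.\<close>

lemma prime_power_tail:
  fixes n p :: nat
  assumes p: "prime p" "p \<le> n"
  defines "r \<equiv> ln p / (real p - 1) - (\<Sum>k | p ^ Suc k \<le> n. ln p / real p ^ Suc k)"
  shows "0 \<le> r" "r \<le> 2 * ln p * min (1 / n) (1 / real p ^ 2)"
proof -
  have p1: "p > 1" "real p \<ge> 2" using prime_ge_2_nat[OF p(1)] by auto
  have ex: "\<exists>k. p ^ Suc k > n"
    using power_gt_expt[of p "Suc n"] p1(1) by (intro exI[of _ n]) simp
  define K where "K = (LEAST k. p ^ Suc k > n)"
  have K: "p ^ Suc K > n" unfolding K_def using ex by (rule LeastI_ex)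
  have K1: "K > 0" using K p by (intro Nat.gr0I) auto
  have set: "{k. p ^ Suc k \<le> n} = {..<K}"
  proof (intro equalityI subsetI)
    fix k assume "k \<in> {k. p ^ Suc k \<le> n}"
    hence "p ^ Suc k < p ^ Suc K" using K unfolding mem_Collect_eq by (rule le_less_trans)
    hence "Suc k < Suc K" using p1 by (subst (asm) power_strict_increasing_iff) auto
    thus "k \<in> {..<K}" by simp
  next
    fix k assume "k \<in> {..<K}"
    hence "k < K" by simp
    hence "\<not>(p ^ Suc k > n)" unfolding K_def by (rule not_less_Least)
    thus "k \<in> {k. p ^ Suc k \<le> n}" by simp
  qed
  have "(\<Sum>k<K. 1 / real p ^ Suc k) = (1 - 1 / real p ^ K) / (real p - 1)"
  proof (induction K)
    case (Suc K)
    show ?case unfolding sum.lessThan_Suc Suc.IH using p1 by (simp add: field_simps)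
  qed simp
  hence geo: "(\<Sum>k<K. ln p / real p ^ Suc k) = ln p * ((1 - 1 / real p ^ K) / (real p - 1))"
    unfolding sum_distrib_left [symmetric] by (simp add: sum_distrib_left [symmetric] divide_inverse)
  hence r: "r = ln p / (real p - 1) * (1 / real p ^ K)"
    unfolding r_def set geo by (simp add: diff_divide_distrib right_diff_distrib, simp add: algebra_simps)
  show "0 \<le> r" unfolding r using p1 by simp
  have "1 / real p ^ K \<le> real p / n"
  proof -
    have "real n \<le> real (p ^ Suc K)" using K by (intro of_nat_mono) simp
    thus ?thesis using p1 p by (simp add: field_simps)
  qed
  moreover have "1 / real p ^ K \<le> 1 / real p"
  proof -
    have "real p ^ 1 \<le> real p ^ K" using p1 K1 by (intro power_increasing) auto
    thus ?thesis using p1 by (simp add: field_simps)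
  qed
  ultimately have "1 / real p ^ K \<le> real p * min (1 / n) (1 / real p ^ 2)"
    using p1 by (simp add: min_def power2_eq_square)
  hence "r \<le> ln p / (real p - 1) * (real p * min (1 / n) (1 / real p ^ 2))"
    unfolding r using p1 by (intro mult_left_mono) auto
  also have "\<dots> = (real p / (real p - 1)) * (ln p * min (1 / n) (1 / real p ^ 2))"
    by simp
  also have "\<dots> \<le> 2 * (ln p * min (1 / n) (1 / real p ^ 2))"
    using p1 by (intro mult_right_mono mult_nonneg_nonneg) (auto simp: field_simps)
  finally show "r \<le> 2 * ln p * min (1 / n) (1 / real p ^ 2)" by simp
qed

lemma prime_weight_minus_mangoldt_weight:
  "0 \<le> prime_weight n - mangoldt_weight n"
  "prime_weight n - mangoldt_weight n \<le> (\<Sum>p | prime p \<and> p \<le> n. 2 * ln p * min (1 / n) (1 / real p ^ 2))"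
  unfolding mangoldt_weight_eq_prime_powers prime_weight_def sum_subtractf [symmetric]
  by (rule sum_nonneg, rule prime_power_tail(1); simp)
     (rule sum_mono, rule prime_power_tail(2); simp)

lemma summable_ln_div_square: "summable (\<lambda>k. 2 * ln (real k) / real k ^ 2)"
proof (rule summable_comparison_test_bigo)
  show "summable (\<lambda>k. norm (real k powr (-3/2)))"
    using summable_real_powr_iff[of "-3/2"] by simp
  show "(\<lambda>k. 2 * ln (real k) / real k ^ 2) \<in> O(\<lambda>k. real k powr (-3/2))"
    by real_asymp
qed

definition ln_square_sum :: real where
  "ln_square_sum = (\<Sum>k. 2 * ln (real k) / real k ^ 2)"

lemma ln_real_nat_nonneg: "ln (real k) \<ge> 0"
  by (cases "k = 0") auto

lemma sum_primes_le_ln_square_sum: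
  assumes "\<And>p. prime p \<Longrightarrow> p \<in> A \<Longrightarrow> f p \<le> 2 * ln (real p) / real p ^ 2" "finite A"
      "\<And>p. p \<in> A \<Longrightarrow> prime p"
  shows "sum f A \<le> ln_square_sum"
proof -
  have "sum f A \<le> (\<Sum>p\<in>A. 2 * ln (real p) / real p ^ 2)" by (intro sum_mono assms)
  also have "\<dots> \<le> ln_square_sum" unfolding ln_square_sum_def
    by (intro sum_le_suminf summable_ln_div_square assms) (auto simp: ln_real_nat_nonneg)
  finally show ?thesis .
qed

lemma prime_weight_bounds:
  assumes "n \<ge> 1"
  shows "ln n - 1 \<le> prime_weight n" "prime_weight n \<le> ln n + 3 + ln_square_sum"
proof -
  show "ln n - 1 \<le> prime_weight n"
    using mangoldt_weight_bounds[OF assms] prime_weight_minus_mangoldt_weight(1)[of n] by linarith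
  have "(\<Sum>p | prime p \<and> p \<le> n. 2 * ln p * min (1 / n) (1 / real p ^ 2)) \<le> ln_square_sum"
    by (rule sum_primes_le_ln_square_sum)
       (auto simp: divide_inverse dest: prime_ge_1_nat intro!: mult_left_mono)
  thus "prime_weight n \<le> ln n + 3 + ln_square_sum"
    using mangoldt_weight_bounds[OF assms] prime_weight_minus_mangoldt_weight(2)[of n] by linarith
qed

text \<open>Dominated convergence for series (Tannery's theorem), with the two bounds on the tails.\<close>

lemma prime_weight_minus_mangoldt_weight_tendsto:
  "(\<lambda>n. prime_weight n - mangoldt_weight n) \<longlonglongrightarrow> 0"
proof -
  define a where "a = (\<lambda>k n. 2 * ln (real k) * min (1 / real n) (1 / real k ^ 2))"
  have le: "norm (a k n) \<le> 2 * ln (real k) / real k ^ 2" for k n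
  proof -
    have "0 \<le> ln (real k)" by (rule ln_real_nat_nonneg)
    thus ?thesis unfolding a_def by (auto simp: divide_inverse min_def intro!: mult_left_mono)
  qed
  have "((\<lambda>n. a k n) \<longlongrightarrow> 0) sequentially" for k
  proof -
    have "((\<lambda>n. 2 * ln (real k) * min (1 / real n) (1 / real k ^ 2)) \<longlongrightarrow>
        2 * ln (real k) * min 0 (1 / real k ^ 2)) sequentially"
      by (intro tendsto_intros lim_1_over_n)
    thus ?thesis unfolding a_def by (simp add: min_def)
  qed
  hence lim: "(\<lambda>n. \<Sum>k. a k n) \<longlonglongrightarrow> (\<Sum>k. 0)"
    using tannerys_theorem[of a "\<lambda>_. 0" sequentially "\<lambda>k. 2 * ln (real k) / real k ^ 2"]
      le summable_ln_div_square by (auto simp: case_prod_unfold)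
  have a_nn: "a k n \<ge> 0" for k n
    unfolding a_def by (cases "k = 0") auto
  have "(\<Sum>p | prime p \<and> p \<le> n. a p n) \<le> (\<Sum>k. a k n)" for n
    by (intro sum_le_suminf summable_comparison_test'[OF summable_ln_div_square] le a_nn) auto
  hence "prime_weight n - mangoldt_weight n \<le> (\<Sum>k. a k n)" for n
    using prime_weight_minus_mangoldt_weight(2)[of n] unfolding a_def by (rule order_trans[rotated])
  with lim show ?thesis
    by (intro tendsto_sandwich[OF _ _ tendsto_const lim[simplified]])
       (use prime_weight_minus_mangoldt_weight(1) in auto)
qed

lemma eventually_prime_weight_le: "eventually (\<lambda>n. prime_weight n \<le> ln n - 0.01) sequentially"
proof -
  have "eventually (\<lambda>n. prime_weight n - mangoldt_weight n < 0.01) sequentially"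
    using prime_weight_minus_mangoldt_weight_tendsto by (rule order_tendstoD) simp
  thus ?thesis using eventually_mangoldt_weight_le by eventually_elim simp
qed

definition prime_recip_weight :: "nat \<Rightarrow> real" where
  "prime_recip_weight n = (\<Sum>p | prime p \<and> p \<le> n. ln p / real p)"

lemma prime_correction_le: 
  assumes "prime p"
  shows "0 \<le> ln (real p) / (real p * (real p - 1))"
    "ln (real p) / (real p * (real p - 1)) \<le> 2 * ln (real p) / real p ^ 2"
    "ln (real p) / (real p - 1) = ln (real p) / real p + ln (real p) / (real p * (real p - 1))"
proof -
  have p: "real p \<ge> 2" using prime_ge_2_nat[OF assms] by simp
  show "0 \<le> ln (real p) / (real p * (real p - 1))" using p by simp
  have "ln (real p) * (1 / (real p * (real p - 1))) \<le> ln (real p) * (2 / real p ^ 2)"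
    using p by (intro mult_left_mono) (auto simp: field_simps power2_eq_square)
  thus "ln (real p) / (real p * (real p - 1)) \<le> 2 * ln (real p) / real p ^ 2"
    by (simp add: mult.commute)
  show "ln (real p) / (real p - 1) = ln (real p) / real p + ln (real p) / (real p * (real p - 1))"
    using p by (simp add: divide_simps) (simp add: algebra_simps)
qed

definition mertens_const :: real where
  "mertens_const = 3 + ln_square_sum"

lemma ln_square_sum_nonneg: "ln_square_sum \<ge> 0"
  using sum_primes_le_ln_square_sum[of "{}"] by simp

text \<open>The higher prime powers contribute a convergent series, so the two-sided bound for
  \<open>mangoldt_weight\<close> carries over to the sum over primes alone.\<close>

lemma mertens_first:
  assumes "n \<ge> 1"
  shows "\<bar>prime_recip_weight n - ln n\<bar> \<le> mertens_const"
proof -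
  have "prime_weight n = prime_recip_weight n + 
      (\<Sum>p | prime p \<and> p \<le> n. ln (real p) / (real p * (real p - 1)))"
    unfolding prime_weight_def prime_recip_weight_def sum.distrib [symmetric]
    by (intro sum.cong refl prime_correction_le(3)) auto
  moreover have "0 \<le> (\<Sum>p | prime p \<and> p \<le> n. ln (real p) / (real p * (real p - 1)))"
    by (intro sum_nonneg prime_correction_le(1)) auto
  moreover have "(\<Sum>p | prime p \<and> p \<le> n. ln (real p) / (real p * (real p - 1))) \<le> ln_square_sum"
    by (intro sum_primes_le_ln_square_sum prime_correction_le(2)) auto
  ultimately show ?thesis
    using prime_weight_bounds[OF assms] unfolding mertens_const_def by linarith
qed

lemma nth_prime_prime: "prime (nth_prime k)"
  using enumerate_in_set[OF primes_infinite, of "k - 1"] unfolding nth_prime_def by simp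

lemma nth_prime_less: "1 \<le> j \<Longrightarrow> j < k \<Longrightarrow> nth_prime j < nth_prime k"
  unfolding nth_prime_def by (intro enumerate_mono primes_infinite) auto

lemma nth_prime_mono: "1 \<le> j \<Longrightarrow> j \<le> k \<Longrightarrow> nth_prime j \<le> nth_prime k"
  using nth_prime_less[of j k] by (cases "j = k") auto

lemma nth_prime_gt: "n \<ge> 1 \<Longrightarrow> nth_prime n > n"
proof (induction n rule: dec_induct)
  case base
  show ?case using prime_gt_1_nat[OF nth_prime_prime] .
next
  case (step n)
  thus ?case using nth_prime_less[of n "Suc n"] by simp
qed

lemma bij_betw_nth_prime:
  assumes "n \<ge> 1"
  shows "bij_betw nth_prime {1..n} {p. prime p \<and> p \<le> nth_prime n}"
  unfolding bij_betw_def
proof (intro conjI equalityI subsetI)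
  show "inj_on nth_prime {1..n}"
    by (rule linorder_inj_onI) (use nth_prime_less in force)+
next
  fix p assume "p \<in> {p. prime p \<and> p \<le> nth_prime n}"
  hence p: "prime p" "p \<le> nth_prime n" by auto
  from enumerate_Ex[of "{p::nat. prime p}" p] p obtain i where "enumerate {p::nat. prime p} i = p"
    by (auto simp: primes_infinite)
  hence i: "nth_prime (Suc i) = p" by (simp add: nth_prime_def)
  have "Suc i \<le> n"
  proof (rule ccontr)
    assume "\<not>Suc i \<le> n"
    thus False using nth_prime_less[of n "Suc i"] i p assms by simp
  qed
  thus "p \<in> nth_prime ` {1..n}" using i by (intro image_eqI[of _ _ "Suc i"]) auto
qed (auto intro: nth_prime_prime nth_prime_mono)

lemma sum_nth_prime:
  assumes "n \<ge> 1"
  shows "(\<Sum>k=1..n. f (nth_prime k)) = (\<Sum>p | prime p \<and> p \<le> nth_prime n. f p)"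
  by (rule sum.reindex_bij_betw[OF bij_betw_nth_prime[OF assms]])

text \<open>By Mertens' first theorem the primes between \<open>n\<^sup>2\<close> and \<open>p\<^sub>n\<close> carry the weight
  \<open>ln p\<^sub>n - 2 ln n\<close> up to a constant, but there are at most \<open>n\<close> of them and each has weight
  \<open>ln p / p \<le> 2 / \<surd>p \<le> 2 / n\<close>.\<close>

lemma ln_nth_prime_le:
  assumes n: "n \<ge> 1"
  shows "ln (nth_prime n) \<le> 2 * ln n + (2 * mertens_const + 2)"
proof -
  define P where "P = {p. prime p \<and> p \<le> nth_prime n}"
  have card: "card P = n" using bij_betw_same_card[OF bij_betw_nth_prime[OF n]] by (simp add: P_def)
  have fin: "finite P" by (simp add: P_def)
  have "prime_recip_weight (nth_prime n) = (\<Sum>p\<in>P. ln p / real p)"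
    by (simp add: prime_recip_weight_def P_def)
  also have "P = {p\<in>P. p \<le> n ^ 2} \<union> {p\<in>P. p > n ^ 2}" by auto
  also have "(\<Sum>p\<in>\<dots>. ln p / real p) = 
      (\<Sum>p\<in>{p\<in>P. p \<le> n ^ 2}. ln p / real p) + (\<Sum>p\<in>{p\<in>P. p > n ^ 2}. ln p / real p)"
    using fin by (intro sum.union_disjoint) auto
  also have "(\<Sum>p\<in>{p\<in>P. p \<le> n ^ 2}. ln p / real p) \<le> prime_recip_weight (n ^ 2)"
    unfolding prime_recip_weight_def by (intro sum_mono2) (auto simp: P_def ln_real_nat_nonneg)
  also have "prime_recip_weight (n ^ 2) \<le> ln (real (n ^ 2)) + mertens_const"
    using mertens_first[of "n ^ 2"] n by simp
  also have "ln (real (n ^ 2)) = 2 * ln n" using n by (simp add: ln_realpow)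
  also have "(\<Sum>p\<in>{p\<in>P. p > n ^ 2}. ln p / real p) \<le> (\<Sum>p\<in>{p\<in>P. p > n ^ 2}. 2 / n)"
  proof (intro sum_mono)
    fix p assume "p \<in> {p\<in>P. p > n ^ 2}"
    hence p: "p > n ^ 2" by auto
    define s where "s = sqrt p"
    have "real n ^ 2 \<le> real p" using p by (metis less_imp_le of_nat_le_iff of_nat_power)
    hence s: "s \<ge> n" unfolding s_def by (rule real_le_rsqrt)
    have sp: "real p = s ^ 2" by (simp add: s_def)
    have s0: "s > 0" using s n by linarith
    have "ln (real p) = 2 * ln s" unfolding sp using s0 by (simp add: ln_realpow)
    also have "\<dots> \<le> 2 * s" using ln_le_minus_one[of s] s0 by simp
    finally have "ln p / real p \<le> 2 * s / s ^ 2" unfolding sp using s0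
      by (intro divide_right_mono) auto
    also have "\<dots> = 2 / s" using s0 by (simp add: power2_eq_square)
    also have "\<dots> \<le> 2 / n" using s n by (intro divide_left_mono) auto
    finally show "ln p / real p \<le> 2 / n" .
  qed
  also have "\<dots> \<le> real (card P) * (2 / n)"
    using card_mono[OF fin, of "{p\<in>P. p > n ^ 2}"] by (simp add: divide_right_mono)
  also have "\<dots> = 2" using n by (simp add: card)
  finally show ?thesis
    using mertens_first[of "nth_prime n"] nth_prime_gt[OF n] by simp
qed

section \<open>The averaging operator on test functions\<close>

text \<open>\<open>avg h x\<close> is the mean of \<open>h (U * x)\<close> for uniform \<open>U\<close>, and \<open>avg_deriv h'\<close> is its derivative when
  \<open>h'\<close> is the derivative of \<open>h\<close>. The map that sends \<open>h\<close> to \<open>\<lambda>x. avg h (x + 1)\<close> is the averaging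
  operator that leaves expectations under the Dickman law invariant.\<close>

definition avg :: "(real \<Rightarrow> real) \<Rightarrow> real \<Rightarrow> real" where
  "avg h x = integral {0..1} (\<lambda>u. h (u * x))"

definition avg_deriv :: "(real \<Rightarrow> real) \<Rightarrow> real \<Rightarrow> real" where
  "avg_deriv h' x = integral {0..1} (\<lambda>u. u * h' (u * x))"

lemma lipschitz_on_real_iff:
  "C-lipschitz_on S f \<longleftrightarrow> 0 \<le> C \<and> (\<forall>x\<in>S. \<forall>y\<in>S. \<bar>f x - f y\<bar> \<le> C * \<bar>x - y\<bar>)" for f :: "real \<Rightarrow> real"
  by (auto simp: lipschitz_on_def dist_real_def)

lemma lipschitz_imp_deriv_le:
  fixes h :: "real \<Rightarrow> real"
  assumes "C-lipschitz_on {0..} h" "x \<ge> 0" "(h has_real_derivative D) (at x within {0..})"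
  shows "\<bar>D\<bar> \<le> C"
proof -
  have "((\<lambda>y. (h y - h x) / (y - x)) \<longlongrightarrow> D) (at x within {0..})"
    using assms(3) by (simp add: has_field_derivative_iff)
  hence "((\<lambda>y. (h y - h x) / (y - x)) \<longlongrightarrow> D) (at_right x)"
    by (rule tendsto_within_subset) (use assms(2) in auto)
  hence "((\<lambda>y. \<bar>(h y - h x) / (y - x)\<bar>) \<longlongrightarrow> \<bar>D\<bar>) (at_right x)"
    by (rule tendsto_rabs)
  moreover have "eventually (\<lambda>y. \<bar>(h y - h x) / (y - x)\<bar> \<le> C) (at_right x)"
    using eventually_at_right_less[of x]
  proof eventually_elim
    case (elim y)
    have "\<bar>h y - h x\<bar> \<le> C * \<bar>y - x\<bar>"
      using lipschitz_onD[OF assms(1), of y x] assms(2) elim by (simp add: dist_real_def)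
    thus ?case using elim by (simp add: abs_divide divide_le_eq)
  qed
  ultimately show ?thesis
    by (rule tendsto_upperbound) simp
qed

lemma continuous_on_scaled:
  fixes h :: "real \<Rightarrow> real"
  assumes "continuous_on {0..} h" "x \<ge> 0"
  shows "continuous_on {0..1} (\<lambda>u. h (u * x))"
  by (rule continuous_on_compose2[OF assms(1)]) (use assms(2) in \<open>auto intro!: continuous_intros\<close>)

text \<open>Functions on \<open>[0,\<infinity>)\<close> are made total and measurable by composing them with \<open>max 0\<close>.\<close>

lemma borel_measurable_max0:
  fixes h :: "real \<Rightarrow> real"
  assumes "continuous_on {0..} h"
  shows "continuous_on UNIV (\<lambda>w. h (max 0 w))" "(\<lambda>w. h (max 0 w)) \<in> borel_measurable borel"
proof -
  show "continuous_on UNIV (\<lambda>w. h (max 0 w))"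
    by (rule continuous_on_compose2[OF assms]) (auto intro!: continuous_intros)
  thus "(\<lambda>w. h (max 0 w)) \<in> borel_measurable borel"
    by (rule borel_measurable_continuous_onI)
qed

lemma H11_lipschitz: "h \<in> H11 \<Longrightarrow> 1-lipschitz_on {0..} h"
  by (simp add: H11_def)

lemma has_integral_id_01: "((\<lambda>u::real. u) has_integral 1 / 2) {0..1}"
  using ident_has_integral[of 0 "1::real"] by simp

lemma has_integral_square_01: "((\<lambda>u::real. u ^ 2) has_integral 1 / 3) {0..1}"
proof -
  have "((\<lambda>u::real. u ^ 2) has_integral (1 ^ 3 / 3 - 0 ^ 3 / 3)) {0..1}"
    by (rule fundamental_theorem_of_calculus)
       (auto simp: has_real_derivative_iff_has_vector_derivative[symmetric] intro!: derivative_eq_intros)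
  thus ?thesis by simp
qed

lemma has_integral_norm_le:
  fixes f g :: "real \<Rightarrow> real"
  assumes "(f has_integral I) S" "(g has_integral J) S" "\<And>x. x \<in> S \<Longrightarrow> norm (f x) \<le> g x"
  shows "norm I \<le> J"
proof -
  have "norm (integral S f) \<le> integral S g"
    by (rule integral_norm_bound_integral) (use assms in \<open>blast intro: has_integral_integrable\<close>)+
  thus ?thesis using assms(1,2) by (simp add: integral_unique)
qed

locale H11_function =
  fixes h h' :: "real \<Rightarrow> real"
  assumes lip: "1-lipschitz_on {0..} h"
    and deriv: "\<And>x. x \<ge> 0 \<Longrightarrow> (h has_real_derivative h' x) (at x within {0..})"
    and lip': "1-lipschitz_on {0..} h'"
begin

lemma deriv_le: "x \<ge> 0 \<Longrightarrow> \<bar>h' x\<bar> \<le> 1"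
  using lipschitz_imp_deriv_le[OF lip _ deriv] by simp

lemma cont: "continuous_on {0..} h" "continuous_on {0..} h'"
  by (rule lipschitz_on_continuous_on, rule lip lip')+

lemma avg_deriv_has_integral:
  "x \<ge> 0 \<Longrightarrow> ((\<lambda>u. u * h' (u * x)) has_integral avg_deriv h' x) {0..1}"
  unfolding avg_deriv_def
  by (intro integrable_integral integrable_continuous_real continuous_intros
      continuous_on_scaled cont)

lemma avg_has_integral: "x \<ge> 0 \<Longrightarrow> ((\<lambda>u. h (u * x)) has_integral avg h x) {0..1}"
  unfolding avg_def
  by (intro integrable_integral integrable_continuous_real continuous_on_scaled cont)

lemma avg_deriv_le:
  assumes "x \<ge> 0" shows "\<bar>avg_deriv h' x\<bar> \<le> 1 / 2"
proof -
  have "norm (avg_deriv h' x) \<le> integral {0..1} (\<lambda>u::real. u)"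
    unfolding avg_deriv_def
    using avg_deriv_has_integral[OF assms] has_integral_id_01 deriv_le assms
    by (intro integral_norm_bound_integral)
       (auto simp: has_integral_integrable_integral abs_mult intro!: mult_left_le)
  thus ?thesis using has_integral_id_01 by (simp add: has_integral_integrable_integral)
qed

lemma avg_deriv_lipschitz: "(1/3)-lipschitz_on {0..} (avg_deriv h')"
  unfolding lipschitz_on_real_iff
proof (intro conjI ballI)
  fix x y :: real assume xy: "x \<in> {0..}" "y \<in> {0..}"
  have "((\<lambda>u. u * h' (u * x) - u * h' (u * y)) has_integral (avg_deriv h' x - avg_deriv h' y)) {0..1}"
    using xy by (intro has_integral_diff avg_deriv_has_integral) auto
  moreover have "((\<lambda>u. u ^ 2 * \<bar>x - y\<bar>) has_integral (1 / 3 * \<bar>x - y\<bar>)) {0..1}"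
    by (intro has_integral_mult_left has_integral_square_01)
  moreover have "norm (u * h' (u * x) - u * h' (u * y)) \<le> u ^ 2 * \<bar>x - y\<bar>" if "u \<in> {0..1}" for u
  proof -
    have "\<bar>h' (u * x) - h' (u * y)\<bar> \<le> 1 * \<bar>u * x - u * y\<bar>"
      using lip' that xy unfolding lipschitz_on_real_iff by auto
    also have "\<dots> = u * \<bar>x - y\<bar>"
      using that by (simp add: abs_mult flip: right_diff_distrib)
    finally have "u * \<bar>h' (u * x) - h' (u * y)\<bar> \<le> u * (u * \<bar>x - y\<bar>)"
      using that by (intro mult_left_mono) auto
    thus ?thesis using that by (simp add: abs_mult power2_eq_square mult.assoc flip: right_diff_distrib)
  qed
  ultimately have "norm (avg_deriv h' x - avg_deriv h' y) \<le> 1 / 3 * \<bar>x - y\<bar>"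
    by (rule has_integral_norm_le)
  thus "\<bar>avg_deriv h' x - avg_deriv h' y\<bar> \<le> 1 / 3 * \<bar>x - y\<bar>" by simp
qed simp

lemma avg_has_deriv:
  assumes "x \<ge> 0"
  shows "(avg h has_real_derivative avg_deriv h' x) (at x within {0..})"
proof -
  have "((\<lambda>x. integral (cbox 0 1) (\<lambda>u. h (u * x))) has_field_derivative
      integral (cbox 0 1) (\<lambda>u. u * h' (u * x))) (at x within {0..})"
  proof (rule leibniz_rule_field_derivative)
    fix x u :: real assume xu: "x \<in> {0..}" "u \<in> cbox 0 1"
    have "((h \<circ> (\<lambda>x. u * x)) has_real_derivative h' (u * x) * u) (at x within {0..})"
    proof (rule DERIV_image_chain)
      show "(h has_real_derivative h' (u * x)) (at (u * x) within (\<lambda>x. u * x) ` {0..})"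
        by (rule DERIV_subset[OF deriv]) (use xu in auto)
    qed (auto intro!: derivative_eq_intros)
    thus "((\<lambda>x. h (u * x)) has_real_derivative u * h' (u * x)) (at x within {0..})"
      by (simp add: o_def mult.commute)
  next
    fix x :: real assume "x \<in> {0..}"
    thus "(\<lambda>u. h (u * x)) integrable_on cbox 0 1"
      using avg_has_integral[of x] by auto
  next
    show "continuous_on ({0..} \<times> cbox 0 1) (\<lambda>(x, u). u * h' (u * x))"
      unfolding case_prod_unfold
      by (intro continuous_intros continuous_on_compose2[OF cont(2)]) auto
  qed (use assms in auto)
  thus ?thesis by (simp add: avg_def [abs_def] avg_deriv_def)
qed

text \<open>Integrate the derivative \<open>h (u x) + u x h' (u x)\<close> of \<open>u * h (u x)\<close> over \<open>[0,1]\<close>.\<close>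

lemma eq_avg:
  assumes "x \<ge> 0"
  shows "h x = x * avg_deriv h' x + avg h x"
proof -
  have "((\<lambda>u. h (u * x) + x * (u * h' (u * x))) has_integral (1 * h (1 * x) - 0 * h (0 * x))) {0..1}"
  proof (rule fundamental_theorem_of_calculus)
    fix u :: real assume u: "u \<in> {0..1}"
    have "((h \<circ> (\<lambda>u. u * x)) has_real_derivative h' (u * x) * x) (at u within {0..1})"
    proof (rule DERIV_image_chain)
      show "(h has_real_derivative h' (u * x)) (at (u * x) within (\<lambda>u. u * x) ` {0..1})"
        by (rule DERIV_subset[OF deriv]) (use u assms in auto)
    qed (auto intro!: derivative_eq_intros)
    hence "((\<lambda>u. u * h (u * x)) has_real_derivative (h (u * x) + x * (u * h' (u * x)))) (at u within {0..1})"
      unfolding o_def by (rule DERIV_cong[OF DERIV_mult[OF DERIV_ident]]) (simp add: algebra_simps)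
    thus "((\<lambda>u. u * h (u * x)) has_vector_derivative (h (u * x) + x * (u * h' (u * x)))) (at u within {0..1})"
      by (simp add: has_real_derivative_iff_has_vector_derivative)
  qed simp
  moreover have "((\<lambda>u. h (u * x) + x * (u * h' (u * x))) has_integral (avg h x + x * avg_deriv h' x)) {0..1}"
    using assms by (intro has_integral_add has_integral_mult_right avg_has_integral avg_deriv_has_integral)
  ultimately show ?thesis by (auto dest: has_integral_unique)
qed

lemma avg_increment:
  assumes "x \<ge> 0"
  shows "((\<lambda>u. avg_deriv h' (x + u)) has_integral (avg h (x + 1) - avg h x)) {0..1}"
proof -
  have "((\<lambda>u. avg_deriv h' (x + u)) has_integral (avg h (x + 1) - avg h (x + 0))) {0..1}"
  proof (rule fundamental_theorem_of_calculus)
    fix u :: real assume u: "u \<in> {0..1}"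
    have "((avg h \<circ> (\<lambda>u. x + u)) has_real_derivative avg_deriv h' (x + u) * 1) (at u within {0..1})"
    proof (rule DERIV_image_chain)
      show "(avg h has_real_derivative avg_deriv h' (x + u)) (at (x + u) within (\<lambda>u. x + u) ` {0..1})"
        by (rule DERIV_subset[OF avg_has_deriv]) (use u assms in auto)
    qed (auto intro!: derivative_eq_intros)
    thus "((\<lambda>u. avg h (x + u)) has_vector_derivative avg_deriv h' (x + u)) (at u within {0..1})"
      by (simp add: has_real_derivative_iff_has_vector_derivative o_def)
  qed simp
  thus ?thesis by simp
qed

text \<open>The right-hand side is the Stein operator of the Dickman law (the size-biased variable is \<open>W + U\<close>)
  applied to \<open>avg_deriv h'\<close>. Thus \<open>avg h\<close> solves the Stein equation not for \<open>h\<close> minus its mean, but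
  for \<open>h\<close> minus its average, and it does so with explicit bounds.\<close>

lemma dickman_generator:
  assumes "x \<ge> 0"
  shows "h x - avg h (x + 1) = x * avg_deriv h' x - integral {0..1} (\<lambda>u. avg_deriv h' (x + u))"
  using eq_avg[OF assms] integral_unique[OF avg_increment[OF assms]] by simp

text \<open>The averaging operator contracts: it halves the Lipschitz constant of \<open>h\<close> and divides that of the
  derivative by 3.\<close>

lemma contraction_in_H11: "(\<lambda>x. 2 * avg h (x + 1)) \<in> H11"
proof -
  have d: "((\<lambda>x. 2 * avg h (x + 1)) has_real_derivative 2 * avg_deriv h' (x + 1)) (at x within {0..})"
    if "x \<ge> 0" for x
  proof -
    have "((avg h \<circ> (\<lambda>x. x + 1)) has_real_derivative avg_deriv h' (x + 1) * 1) (at x within {0..})"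
    proof (rule DERIV_image_chain)
      show "(avg h has_real_derivative avg_deriv h' (x + 1)) (at (x + 1) within (\<lambda>x. x + 1) ` {0..})"
        by (rule DERIV_subset[OF avg_has_deriv]) (use that in auto)
    qed (auto intro!: derivative_eq_intros)
    from DERIV_cmult[OF this, of 2] show ?thesis by (simp add: o_def)
  qed
  have "1-lipschitz_on {0..} (\<lambda>x. 2 * avg h (x + 1))"
  proof (rule lipschitz_onI)
    fix x y :: real assume xy: "x \<in> {0..}" "y \<in> {0..}"
    have "norm (2 * avg h (x + 1) - 2 * avg h (y + 1)) \<le> 1 * norm (x - y)"
    proof (rule field_differentiable_bound[OF convex_real_interval(1)[of 0]])
      fix z :: real assume z: "z \<in> {0..}"
      show "((\<lambda>x. 2 * avg h (x + 1)) has_real_derivative 2 * avg_deriv h' (z + 1)) (at z within {0..})"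
        by (rule d) (use z in simp)
      show "norm (2 * avg_deriv h' (z + 1)) \<le> 1"
        using avg_deriv_le[of "z + 1"] z by (simp add: abs_mult)
    qed (use xy in auto)
    thus "dist (2 * avg h (x + 1)) (2 * avg h (y + 1)) \<le> 1 * dist x y" by (simp add: dist_norm)
  qed simp
  moreover have "1-lipschitz_on {0..} (\<lambda>x. 2 * avg_deriv h' (x + 1))"
    unfolding lipschitz_on_real_iff
  proof (intro conjI ballI)
    fix x y :: real assume xy: "x \<in> {0..}" "y \<in> {0..}"
    have "\<bar>avg_deriv h' (x + 1) - avg_deriv h' (y + 1)\<bar> \<le> 1 / 3 * \<bar>(x + 1) - (y + 1)\<bar>"
      using lipschitz_onD[OF avg_deriv_lipschitz, of "x + 1" "y + 1"] xy by (simp add: dist_real_def)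
    hence "\<bar>avg_deriv h' (x + 1) - avg_deriv h' (y + 1)\<bar> \<le> 1 / 3 * \<bar>x - y\<bar>" by simp
    moreover have "\<bar>2 * avg_deriv h' (x + 1) - 2 * avg_deriv h' (y + 1)\<bar> =
        2 * \<bar>avg_deriv h' (x + 1) - avg_deriv h' (y + 1)\<bar>"
      by (simp only: right_diff_distrib [symmetric] abs_mult abs_numeral)
    ultimately show "\<bar>2 * avg_deriv h' (x + 1) - 2 * avg_deriv h' (y + 1)\<bar> \<le> 1 * \<bar>x - y\<bar>"
      using abs_ge_zero[of "x - y"] by argo
  qed simp
  ultimately show ?thesis unfolding H11_def mem_Collect_eq
    by (intro conjI exI[of _ "\<lambda>x. 2 * avg_deriv h' (x + 1)"] allI impI d)
qed

lemma continuous_on_avg_shift: "continuous_on {0..} (\<lambda>x. avg h (x + 1))"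
proof -
  have "continuous_on {0..} (\<lambda>x. 2 * avg h (x + 1))"
    by (rule lipschitz_on_continuous_on[OF H11_lipschitz[OF contraction_in_H11]])
  from continuous_on_mult_left[OF this, of "1 / 2"] show ?thesis by simp
qed

end

lemma H11_obtain:
  assumes "h \<in> H11" obtains h' where "H11_function h h'"
  using assms unfolding H11_def H11_function_def by blast

section \<open>Prime masses approximate the uniform law\<close>

text \<open>A Stieltjes sum against \<open>A\<close> is compared with the integral against Lebesgue measure. Summation by
  parts moves the difference \<open>A - t\<close> onto the increments of \<open>g\<close>; the remaining Riemann sum differs
  from the integral by the mesh times the Lipschitz constant.\<close>

lemma stieltjes_sum_approx:
  fixes G t A :: "nat \<Rightarrow> real" and g :: "real \<Rightarrow> real"
  assumes t0: "t 0 = 0" "A 0 = 0"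
    and mono: "\<And>k. k < n \<Longrightarrow> t k \<le> t (Suc k)"
    and mesh: "\<And>k. k < n \<Longrightarrow> t (Suc k) - t k \<le> \<delta>"
    and close: "\<And>k. k \<le> n \<Longrightarrow> \<bar>A k - t k\<bar> \<le> \<epsilon>"
    and bnd: "\<And>x. x \<ge> 0 \<Longrightarrow> \<bar>g x\<bar> \<le> B"
    and lip: "K-lipschitz_on {0..} g"
  shows "\<bar>(\<Sum>k<n. (A (Suc k) - A k) * g (t (Suc k))) - integral {0..t n} g\<bar>
           \<le> \<epsilon> * (B + K * t n) + K * \<delta> * t n"
proof -
  have K: "K \<ge> 0" using lip by (rule lipschitz_on_nonneg)
  have eps: "\<epsilon> \<ge> 0" using close[of 0] t0 by simp
  have nn: "t m \<ge> 0" if "m \<le> n" for m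
    using that by (induction m) (use t0 in simp, meson Suc_le_lessD less_imp_le mono order_trans)
  have int: "g integrable_on {a..b}" if "a \<ge> 0" for a b
    by (intro integrable_continuous_real continuous_on_subset[OF lipschitz_on_continuous_on[OF lip]])
       (use that in auto)
  \<comment> \<open>Summation by parts in the form of an induction, then the Riemann sum.\<close>
  define e where "e = (\<lambda>k. A k - t k)"
  have 1: "\<bar>(\<Sum>k<m. (e (Suc k) - e k) * g (t (Suc k))) - e m * g (t m)\<bar> \<le> \<epsilon> * K * t m"
    if "m \<le> n" for m
    using that
  proof (induction m)
    case (Suc m)
    have "\<bar>g (t (Suc m)) - g (t m)\<bar> \<le> K * (t (Suc m) - t m)"
      using lipschitz_onD[OF lip, of "t (Suc m)" "t m"] nn[of m] nn[of "Suc m"] mono[of m] Suc.prems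
      by (simp add: dist_real_def)
    moreover have "\<bar>e m\<bar> \<le> \<epsilon>" using close[of m] Suc.prems by (simp add: e_def)
    ultimately have "\<bar>e m * (g (t (Suc m)) - g (t m))\<bar> \<le> \<epsilon> * (K * (t (Suc m) - t m))"
      unfolding abs_mult using eps by (intro mult_mono) auto
    thus ?case using Suc by (simp add: algebra_simps)
  qed (simp add: t0 e_def)
  have 2: "\<bar>(\<Sum>k<m. (t (Suc k) - t k) * g (t (Suc k))) - integral {0..t m} g\<bar> \<le> K * \<delta> * t m"
    if "m \<le> n" for m
    using that
  proof (induction m)
    case (Suc m)
    define a b where "a = t m" and "b = t (Suc m)"
    have ab: "0 \<le> a" "a \<le> b" "b - a \<le> \<delta>"
      using nn[of m] mono[of m] mesh[of m] Suc.prems by (simp_all add: a_def b_def)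
    have split: "integral {0..b} g = integral {0..a} g + integral {a..b} g"
      by (rule Henstock_Kurzweil_Integration.integral_combine[symmetric]) (use ab int[of 0] in auto)
    have "((\<lambda>u. g b - g u) has_integral ((b - a) * g b - integral {a..b} g)) {a..b}"
      using has_integral_const_real[of "g b" a b] int[of a b] ab
      by (intro has_integral_diff integrable_integral) auto
    moreover have "((\<lambda>u. K * \<delta>) has_integral ((b - a) * (K * \<delta>))) {a..b}"
      using has_integral_const_real[of "K * \<delta>" a b] ab by simp
    moreover have "norm (g b - g u) \<le> K * \<delta>" if "u \<in> {a..b}" for u
    proof -
      have "norm (g b - g u) \<le> K * \<bar>b - u\<bar>"
        using lipschitz_onD[OF lip, of b u] that ab by (simp add: dist_real_def)
      also have "\<dots> \<le> K * \<delta>" using that ab K by (intro mult_left_mono) auto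
      finally show ?thesis .
    qed
    ultimately have "norm ((b - a) * g b - integral {a..b} g) \<le> (b - a) * (K * \<delta>)"
      by (rule has_integral_norm_le)
    moreover have "\<bar>(\<Sum>k<m. (t (Suc k) - t k) * g (t (Suc k))) - integral {0..a} g\<bar> \<le> K * \<delta> * a"
      using Suc unfolding a_def by simp
    ultimately show ?case unfolding sum.lessThan_Suc b_def[symmetric] a_def[symmetric] split
      by (simp add: algebra_simps)
  qed (simp add: t0)
  have 3: "\<bar>e n * g (t n)\<bar> \<le> \<epsilon> * B"
    unfolding abs_mult using close[of n] bnd[of "t n"] nn[of n] eps
    by (intro mult_mono) (auto simp: e_def)
  have "(\<Sum>k<n. (A (Suc k) - A k) * g (t (Suc k))) = 
    (\<Sum>k<n. (e (Suc k) - e k) * g (t (Suc k))) + (\<Sum>k<n. (t (Suc k) - t k) * g (t (Suc k)))"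
    unfolding sum.distrib [symmetric] by (intro sum.cong) (auto simp: e_def algebra_simps)
  thus ?thesis using 1[of n] 2[of n] 3 by (simp add: algebra_simps)
qed

text \<open>The masses \<open>ln p\<^sub>k / (p\<^sub>k L)\<close> at the points \<open>ln p\<^sub>k / L\<close> approximate Lebesgue measure on \<open>[0,1]\<close>: by
  Mertens' first theorem their distribution function is within \<open>O(1/L)\<close> of the identity at every
  such point. The mesh is \<open>O(1/L)\<close> for the same reason, since no single mass exceeds \<open>1/L\<close>.\<close>

lemma prime_sum_approx_integral:
  fixes g :: "real \<Rightarrow> real" and L :: real
  assumes n: "n \<ge> 1" and s: "s \<ge> 0"
    and bnd: "\<And>x. x \<ge> 0 \<Longrightarrow> \<bar>g x\<bar> \<le> B" and lip: "K-lipschitz_on {0..} g"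
  defines "L \<equiv> ln (real (nth_prime n))"
  shows "\<bar>(\<Sum>k=1..n. ln (nth_prime k) / (L * nth_prime k) * g (s + ln (nth_prime k) / L))
            - integral {0..1} (\<lambda>u. g (s + u))\<bar>
          \<le> (mertens_const * (B + K) + K * (1 + 2 * mertens_const)) / L"
proof -
  define M where "M = mertens_const"
  define t A :: "nat \<Rightarrow> real" where "t = (\<lambda>k. if k = 0 then 0 else ln (nth_prime k) / L)"
    and "A = (\<lambda>m. \<Sum>k=1..m. ln (nth_prime k) / (L * nth_prime k))"
  have L: "L > 0" using nth_prime_gt[OF n] n by (simp add: L_def)
  have pos: "ln (real (nth_prime k)) \<ge> 0" for k by (rule ln_real_nat_nonneg)
  have ppos: "real (nth_prime k) > 0" for k using prime_gt_0_nat[OF nth_prime_prime[of k]] by simp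
  have tn: "t n = 1" using n L by (simp add: t_def L_def)
  have Ak: "A k = prime_recip_weight (nth_prime k) / L" if "k \<ge> 1" for k
    unfolding A_def prime_recip_weight_def sum_nth_prime[OF that, of "\<lambda>p. ln p / (L * p)"]
    by (simp add: sum_divide_distrib mult.commute)
  have M: "M \<ge> 0" using ln_square_sum_nonneg by (simp add: M_def mertens_const_def)
  have close: "\<bar>A k - t k\<bar> \<le> M / L" for k
  proof (cases "k = 0")
    case False
    hence k: "k \<ge> 1" by simp
    have "A k - t k = (prime_recip_weight (nth_prime k) - ln (nth_prime k)) / L"
      using k by (simp add: Ak t_def diff_divide_distrib)
    also have "\<bar>\<dots>\<bar> \<le> M / L"
      using mertens_first[of "nth_prime k"] nth_prime_gt[OF k] L
      by (simp add: M_def divide_right_mono)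
    finally show ?thesis .
  qed (use M L in \<open>simp add: A_def t_def\<close>)
  have A_Suc: "A (Suc k) - A k = ln (nth_prime (Suc k)) / (L * nth_prime (Suc k))" for k
    by (simp add: A_def)
  have mesh: "t (Suc k) - t k \<le> (1 + 2 * M) / L" for k
  proof -
    have "ln (real (nth_prime (Suc k))) \<le> real (nth_prime (Suc k))"
      using ln_le_minus_one[OF ppos[of "Suc k"]] by simp
    hence "ln (nth_prime (Suc k)) / (L * nth_prime (Suc k)) \<le> 1 / L"
      using L ppos[of "Suc k"] by (simp add: field_simps)
    thus ?thesis using close[of k] close[of "Suc k"] A_Suc[of k] by (simp add: add_divide_distrib)
  qed
  have tmono: "t k \<le> t (Suc k)" for k
  proof (cases "k = 0")
    case False
    hence "real (nth_prime k) \<le> real (nth_prime (Suc k))"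
      using nth_prime_mono[of k "Suc k"] by simp
    thus ?thesis using False L ppos[of k] by (simp add: t_def divide_right_mono)
  qed (use L pos in \<open>simp add: t_def\<close>)
  have "\<bar>(\<Sum>k<n. (A (Suc k) - A k) * g (s + t (Suc k))) - integral {0..t n} (\<lambda>u. g (s + u))\<bar>
           \<le> M / L * (B + K * t n) + K * ((1 + 2 * M) / L) * t n"
  proof (rule stieltjes_sum_approx)
    show "K-lipschitz_on {0..} (\<lambda>u. g (s + u))"
    proof (rule lipschitz_onI)
      fix x y :: real assume "x \<in> {0..}" "y \<in> {0..}"
      thus "dist (g (s + x)) (g (s + y)) \<le> K * dist x y"
        using lipschitz_onD[OF lip, of "s + x" "s + y"] s by (simp add: dist_real_def)
    qed (rule lipschitz_on_nonneg[OF lip])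
  qed (use s bnd mesh tmono close in \<open>auto simp: t_def A_def\<close>)
  also have "(\<Sum>k<n. (A (Suc k) - A k) * g (s + t (Suc k))) =
      (\<Sum>k=1..n. ln (nth_prime k) / (L * nth_prime k) * g (s + ln (nth_prime k) / L))"
    unfolding A_Suc t_def
    by (rule sum.reindex_bij_witness[of _ "\<lambda>k. k - 1" Suc]) auto
  also have "M / L * (B + K * t n) + K * ((1 + 2 * M) / L) * t n = (M * (B + K) + K * (1 + 2 * M)) / L"
    using L by (simp add: tn field_simps)
  finally show ?thesis by (simp add: tn M_def)
qed

section \<open>The Dickman law\<close>

abbreviation unif01 :: "real measure" where
  "unif01 \<equiv> uniform_measure lborel {0..1}"

lemma unif01_density: "unif01 = density lborel (\<lambda>x. ennreal (indicator {0..1} x))"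
  unfolding uniform_measure_def
  by (intro density_cong) (auto simp: indicator_def)

lemma prob_space_unif01: "prob_space unif01"
  by (rule prob_space_uniform_measure) auto

lemma integral_unif01:
  fixes f :: "real \<Rightarrow> real"
  assumes "continuous_on {0..1} f" and [measurable]: "f \<in> borel_measurable borel"
  shows "integral\<^sup>L unif01 f = integral {0..1} f"
proof -
  have "integral\<^sup>L unif01 f = (LINT x:{0..1}|lborel. f x)"
    unfolding unif01_density set_lebesgue_integral_def by (subst integral_density) auto
  also have "\<dots> = integral {0..1} f"
    by (rule set_borel_integral_eq_integral) (rule borel_integrable_atLeastAtMost', rule assms)
  finally show ?thesis .
qed

locale dickman_law =
  fixes \<mu> :: "real measure"
  assumes law: "standard_dickman_law \<mu>"
begin

sublocale prob_space \<mu> using law by (simp add: standard_dickman_law_def)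

lemma sets_mu [measurable_cong]: "sets \<mu> = sets borel"
  using law by (simp add: standard_dickman_law_def)

lemma nonneg: "AE w in \<mu>. 0 \<le> w"
  using law by (simp add: standard_dickman_law_def)

lemma fixed_point: "distr (unif01 \<Otimes>\<^sub>M \<mu>) borel (\<lambda>(u, w). u * (w + 1)) = \<mu>"
  using law by (simp add: standard_dickman_law_def)

lemma expectation_fixed_point:
  fixes f :: "real \<Rightarrow> real"
  assumes f: "integrable \<mu> f"
  shows "expectation f = expectation (\<lambda>w. \<integral>u. f (u * (w + 1)) \<partial>unif01)"
    and "integrable \<mu> (\<lambda>w. \<integral>u. f (u * (w + 1)) \<partial>unif01)"
proof -
  interpret U: prob_space unif01 by (rule prob_space_unif01)
  interpret P: pair_sigma_finite unif01 \<mu> ..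
  have [measurable]: "f \<in> borel_measurable borel"
    using f by (simp add: measurable_cong_sets[OF sets_mu refl] integrable_iff_bounded)
  have "integrable (distr (unif01 \<Otimes>\<^sub>M \<mu>) borel (\<lambda>(u, w). u * (w + 1))) f"
    unfolding fixed_point by (rule f)
  hence int: "integrable (unif01 \<Otimes>\<^sub>M \<mu>) (\<lambda>(u, w). f (u * (w + 1)))"
    by (subst (asm) integrable_distr_eq) (auto simp: case_prod_unfold)
  have "expectation f = integral\<^sup>L (distr (unif01 \<Otimes>\<^sub>M \<mu>) borel (\<lambda>(u, w). u * (w + 1))) f"
    by (simp only: fixed_point)
  also have "\<dots> = (\<integral>x. (case x of (u, w) \<Rightarrow> f (u * (w + 1))) \<partial>(unif01 \<Otimes>\<^sub>M \<mu>))"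
    by (subst integral_distr) (auto simp: case_prod_unfold)
  also have "\<dots> = expectation (\<lambda>w. \<integral>u. f (u * (w + 1)) \<partial>unif01)"
    by (rule P.integral_snd [symmetric]) (rule int)
  finally show "expectation f = expectation (\<lambda>w. \<integral>u. f (u * (w + 1)) \<partial>unif01)" .
  show "integrable \<mu> (\<lambda>w. \<integral>u. f (u * (w + 1)) \<partial>unif01)"
    by (rule P.integrable_snd) (rule int)
qed

text \<open>The fixed-point equation for the mean, \<open>m = (m + 1) / 2\<close>, does not exclude an infinite mean. It is
  therefore first applied to truncated variables.\<close>

definition trunc_mean :: "real \<Rightarrow> real \<Rightarrow> real" where
  "trunc_mean t a = expectation (\<lambda>w. min t (a * max 0 w))"

lemma integrable_trunc: "t \<ge> 0 \<Longrightarrow> a \<ge> 0 \<Longrightarrow> integrable \<mu> (\<lambda>w. min t (a * max 0 w))"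
  by (rule integrable_const_bound[where B = t]) auto

text \<open>As \<open>min t\<close> is concave, averaging the uniform variable before the truncation can only
  increase the value;
  \<open>min t (x + y) \<le> min t x + y\<close> splits off the summand 1.\<close>

lemma trunc_mean_halve:
  assumes ta: "t \<ge> 0" "a \<ge> 0"
  shows "trunc_mean t a \<le> trunc_mean t (a / 2) + a / 2"
proof -
  interpret U: prob_space unif01 by (rule prob_space_unif01)
  have "trunc_mean t a = expectation (\<lambda>w. \<integral>u. min t (a * max 0 (u * (w + 1))) \<partial>unif01)"
    unfolding trunc_mean_def by (rule expectation_fixed_point(1)[OF integrable_trunc[OF ta]])
  also have "\<dots> \<le> expectation (\<lambda>w. min t (a / 2 * max 0 w) + a / 2)"
  proof (rule integral_mono_AE)
    show "AE w in \<mu>. (\<integral>u. min t (a * max 0 (u * (w + 1))) \<partial>unif01) \<le> min t (a / 2 * max 0 w) + a / 2"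
      using nonneg
    proof eventually_elim
      case (elim w)
      have [simp]: "integrable unif01 (\<lambda>u. min t (a * max 0 (u * (w + 1))))"
        by (rule U.integrable_const_bound[where B = t]) (use ta in auto)
      have "(\<integral>u. min t (a * max 0 (u * (w + 1))) \<partial>unif01) \<le> (\<integral>u. t \<partial>unif01)"
        by (rule integral_mono) (use ta in auto)
      hence 1: "(\<integral>u. min t (a * max 0 (u * (w + 1))) \<partial>unif01) \<le> t" by (simp add: U.prob_space)
      have AE: "AE u in unif01. u \<in> {0..1}" by (rule AE_uniform_measureI) auto
      have int: "integrable unif01 (\<lambda>u. a * (w + 1) * u)"
        by (rule U.integrable_const_bound[where B = "a * (w + 1)"])
           (use AE in eventually_elim, use ta elim in \<open>auto simp: abs_mult mult_left_le\<close>)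
      have "(\<integral>u. min t (a * max 0 (u * (w + 1))) \<partial>unif01) \<le> (\<integral>u. a * (w + 1) * u \<partial>unif01)"
      proof (rule integral_mono_AE)
        show "AE u in unif01. min t (a * max 0 (u * (w + 1))) \<le> a * (w + 1) * u"
          using AE by eventually_elim (use elim in \<open>auto simp: max_def min_def mult_ac\<close>)
      qed (use int in auto)
      also have "\<dots> = integral {0..1} (\<lambda>u. a * (w + 1) * u)"
        by (intro integral_unif01 continuous_intros) auto
      also have "\<dots> = a * (w + 1) / 2"
        using has_integral_mult_right[OF has_integral_id_01, of "a * (w + 1)"]
        by (simp add: integral_unique)
      finally have 2: "(\<integral>u. min t (a * max 0 (u * (w + 1))) \<partial>unif01) \<le> a * (w + 1) / 2" .
      show ?case using 1 2 ta elim by (auto simp: min_def max_def field_simps)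
    qed
  next
    show "integrable \<mu> (\<lambda>w. min t (a / 2 * max 0 w) + a / 2)"
      using ta by (intro Bochner_Integration.integrable_add integrable_trunc) auto
  qed (rule expectation_fixed_point(2)[OF integrable_trunc[OF ta]])
  also have "\<dots> = trunc_mean t (a / 2) + a / 2"
    unfolding trunc_mean_def
    using ta integrable_trunc[of t "a / 2"]
    by (subst Bochner_Integration.integral_add) (simp_all add: prob_space)
  finally show ?thesis .
qed

text \<open>Halving \<open>k\<close> times adds less than \<open>1/2 + 1/4 + ... = 1\<close>, and the truncated mean of \<open>w / 2 ^ k\<close>
  vanishes in the limit by dominated convergence.\<close>

lemma trunc_mean_le_1:
  assumes t: "t \<ge> 0"
  shows "trunc_mean t 1 \<le> 1"
proof -
  have *: "trunc_mean t 1 \<le> trunc_mean t ((1 / 2) ^ k) + (1 - (1 / 2) ^ k)" for k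
  proof (induction k)
    case (Suc k)
    thus ?case using trunc_mean_halve[of t "(1 / 2) ^ k"] t by simp
  qed simp
  have le: "trunc_mean t 1 \<le> trunc_mean t ((1 / 2) ^ k) + 1" for k
    using *[of k] by (rule order_trans) simp
  have lim0: "(\<lambda>k. (1 / 2 :: real) ^ k) \<longlonglongrightarrow> 0" by (rule LIMSEQ_power_zero) simp
  have "(\<lambda>k. trunc_mean t ((1 / 2) ^ k)) \<longlonglongrightarrow> expectation (\<lambda>_. 0)"
    unfolding trunc_mean_def
  proof (rule integral_dominated_convergence[where w = "\<lambda>_. t"])
    show "AE w in \<mu>. (\<lambda>k. min t ((1 / 2) ^ k * max 0 w)) \<longlonglongrightarrow> 0"
    proof (rule AE_I2)
      fix w
      have "(\<lambda>k. min t ((1 / 2) ^ k * max 0 w)) \<longlonglongrightarrow> min t (0 * max 0 w)"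
        by (intro tendsto_intros lim0)
      thus "(\<lambda>k. min t ((1 / 2) ^ k * max 0 w)) \<longlonglongrightarrow> 0" using t by simp
    qed
  qed (use t in auto)
  hence "(\<lambda>k. trunc_mean t ((1 / 2) ^ k) + 1) \<longlonglongrightarrow> 0 + 1"
    by (intro tendsto_add tendsto_const) simp
  thus ?thesis using le by (intro LIMSEQ_le_const[of _ 1]) auto
qed

lemma integrable_id: "integrable \<mu> (\<lambda>w. w)"
proof -
  define E where "E = (\<lambda>n::nat. trunc_mean (real n) 1)"
  have "incseq E"
    unfolding E_def trunc_mean_def
    by (intro monoI integral_mono integrable_trunc) auto
  moreover have "bdd_above (range E)"
    by (rule bdd_aboveI2[where M = 1]) (auto simp: E_def trunc_mean_le_1)
  ultimately obtain l where l: "E \<longlonglongrightarrow> l"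
    using LIMSEQ_incseq_SUP by blast
  have "integrable \<mu> (\<lambda>w. max 0 w)"
  proof (rule integral_monotone_convergence_nonneg(1))
    show "integrable \<mu> (\<lambda>w. min (real n) (1 * max 0 w))" for n
      by (rule integrable_trunc) auto
    show "(\<lambda>n. expectation (\<lambda>w. min (real n) (1 * max 0 w))) \<longlonglongrightarrow> l"
      using l by (simp only: E_def trunc_mean_def)
    show "AE w in \<mu>. (\<lambda>n. min (real n) (1 * max 0 w)) \<longlonglongrightarrow> max 0 w"
    proof (rule AE_I2)
      fix w
      have "eventually (\<lambda>n. min (real n) (1 * max 0 w) = max 0 w) sequentially"
        using eventually_ge_at_top[of "nat \<lceil>max 0 w\<rceil>"]
      proof eventually_elim
        case (elim n)
        hence "max 0 w \<le> real n" by linarith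
        thus ?case by simp
      qed
      thus "(\<lambda>n. min (real n) (1 * max 0 w)) \<longlonglongrightarrow> max 0 w"
        by (rule tendsto_eventually)
    qed
  qed (auto simp: mono_def)
  moreover have "AE w in \<mu>. max 0 w = w" using nonneg by eventually_elim simp
  ultimately show ?thesis by (subst integrable_cong_AE[of _ _ "\<lambda>w. max 0 w"]) auto
qed

lemma integrable_H11:
  fixes h :: "real \<Rightarrow> real"
  assumes "1-lipschitz_on {0..} h"
  shows "integrable \<mu> (\<lambda>w. h (max 0 w))"
proof (rule Bochner_Integration.integrable_bound)
  show "integrable \<mu> (\<lambda>w. \<bar>h 0\<bar> + \<bar>w\<bar>)"
    by (intro Bochner_Integration.integrable_add integrable_abs integrable_id) simp
  show "(\<lambda>w. h (max 0 w)) \<in> borel_measurable \<mu>"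
    using borel_measurable_max0(2)[OF lipschitz_on_continuous_on[OF assms]]
    by (simp add: measurable_cong_sets[OF sets_mu refl])
  show "AE w in \<mu>. norm (h (max 0 w)) \<le> norm (\<bar>h 0\<bar> + \<bar>w\<bar>)"
  proof (rule AE_I2)
    fix w
    show "norm (h (max 0 w)) \<le> norm (\<bar>h 0\<bar> + \<bar>w\<bar>)"
      using lipschitz_onD[OF assms, of "max 0 w" 0] by (auto simp: dist_real_def max_def split: if_splits)
  qed
qed

text \<open>Expectations under the Dickman law do not change when \<open>h\<close> is averaged: this is the fixed-point
  equation after integrating out the uniform variable.\<close>

lemma expectation_avg:
  assumes "H11_function h h'"
  shows "expectation (\<lambda>w. h (max 0 w)) = expectation (\<lambda>w. avg h (max 0 w + 1))"
proof -
  interpret H11_function h h' by fact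
  note [measurable] = borel_measurable_max0(2)[OF cont(1)]
  have ae: "AE w in \<mu>. (\<integral>u. h (max 0 (u * (w + 1))) \<partial>unif01) = avg h (max 0 w + 1)"
    using nonneg
  proof eventually_elim
    case (elim w)
    have "(\<integral>u. h (max 0 (u * (w + 1))) \<partial>unif01) = integral {0..1} (\<lambda>u. h (max 0 (u * (w + 1))))"
    proof (rule integral_unif01)
      show "continuous_on {0..1} (\<lambda>u. h (max 0 (u * (w + 1))))"
        by (rule continuous_on_compose2[OF borel_measurable_max0(1)[OF cont(1)]])
           (auto intro!: continuous_intros)
    qed measurable
    also have "\<dots> = integral {0..1} (\<lambda>u. h (u * (w + 1)))"
      by (rule integral_cong) (use elim in auto)
    finally show ?case using elim by (simp add: avg_def)
  qed
  note int = integrable_H11[OF lip]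
  have "expectation (\<lambda>w. h (max 0 w)) = expectation (\<lambda>w. \<integral>u. h (max 0 (u * (w + 1))) \<partial>unif01)"
    by (rule expectation_fixed_point(1)[OF int])
  also have "\<dots> = expectation (\<lambda>w. avg h (max 0 w + 1))"
  proof (rule integral_cong_AE)
    show "(\<lambda>w. \<integral>u. h (max 0 (u * (w + 1))) \<partial>unif01) \<in> borel_measurable \<mu>"
      by (rule borel_measurable_integrable[OF expectation_fixed_point(2)[OF int]])
    show "(\<lambda>w. avg h (max 0 w + 1)) \<in> borel_measurable \<mu>"
      using borel_measurable_max0(2)[OF continuous_on_avg_shift]
      by (simp add: measurable_cong_sets[OF sets_mu refl])
  qed (rule ae)
  finally show ?thesis .
qed

lemma expectation_id: "expectation (\<lambda>w. w) = 1"
proof -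
  interpret U: prob_space unif01 by (rule prob_space_unif01)
  have inner: "(\<integral>u. u * (w + 1) \<partial>unif01) = (w + 1) / 2" for w
  proof -
    have "(\<integral>u. u * (w + 1) \<partial>unif01) = integral {0..1} (\<lambda>u. u * (w + 1))"
      by (intro integral_unif01 continuous_intros) auto
    also have "\<dots> = (w + 1) / 2"
      using has_integral_mult_left[OF has_integral_id_01, of "w + 1"]
      by (simp add: integral_unique)
    finally show ?thesis .
  qed
  have "expectation (\<lambda>w. w) = expectation (\<lambda>w. (w + 1) / 2)"
    using expectation_fixed_point(1)[OF integrable_id] unfolding inner .
  also have "\<dots> = (expectation (\<lambda>w. w) + 1) / 2"
    using integrable_id by (simp add: prob_space)
  finally show ?thesis by simp
qed

end

section \<open>Size bias of geometric variables\<close>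

text \<open>The weights of the geometric law satisfy \<open>P(X = m + 1) = (1 - p) P(X = m)\<close>; shift the index.\<close>

lemma expectation_geometric_size_bias:
  fixes \<phi> :: "nat \<Rightarrow> real"
  assumes p: "p \<in> {0<..1}" and int: "integrable (geometric_pmf p) (\<lambda>m. real m * \<phi> m)"
  shows "measure_pmf.expectation (geometric_pmf p) (\<lambda>m. real m * \<phi> m) =
    (1 - p) * measure_pmf.expectation (geometric_pmf p) (\<lambda>m. real (Suc m) * \<phi> (Suc m))"
proof -
  have dens: "integrable (geometric_pmf p) f \<longleftrightarrow> summable (\<lambda>m. norm ((1 - p) ^ m * p * f m))"
    for f :: "nat \<Rightarrow> real"
    unfolding measure_pmf_eq_density using p
    by (subst integrable_density) (auto simp: integrable_count_space_nat_iff)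
  have expec: "measure_pmf.expectation (geometric_pmf p) f = (\<Sum>m. (1 - p) ^ m * p * f m)"
    if "integrable (geometric_pmf p) f" for f :: "nat \<Rightarrow> real"
  proof -
    have "measure_pmf.expectation (geometric_pmf p) f =
        integral\<^sup>L (count_space UNIV) (\<lambda>m. (1 - p) ^ m * p * f m)"
      unfolding measure_pmf_eq_density using p by (subst integral_density) auto
    also have "\<dots> = (\<Sum>m. (1 - p) ^ m * p * f m)"
      by (rule integral_count_space_nat)
         (use that in \<open>simp add: dens integrable_count_space_nat_iff\<close>)
    finally show ?thesis .
  qed
  define a where "a = (\<lambda>m. (1 - p) ^ m * p * (real m * \<phi> m))"
  have a_Suc: "a (Suc m) = (1 - p) * ((1 - p) ^ m * p * (real (Suc m) * \<phi> (Suc m)))" for m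
    by (simp add: a_def)
  have sm: "summable (\<lambda>m. norm (a m))" using int unfolding dens a_def .
  hence smS: "summable (\<lambda>m. norm (a (Suc m)))" by (subst summable_Suc_iff)
  have int': "integrable (geometric_pmf p) (\<lambda>m. real (Suc m) * \<phi> (Suc m))" if "p < 1"
    unfolding dens
    by (rule summable_mult_D[of "1 - p"]) (use smS that in \<open>simp_all add: a_Suc abs_mult\<close>)
  show "measure_pmf.expectation (geometric_pmf p) (\<lambda>m. real m * \<phi> m) =
    (1 - p) * measure_pmf.expectation (geometric_pmf p) (\<lambda>m. real (Suc m) * \<phi> (Suc m))"
  proof (cases "p < 1")
    case True
    have "measure_pmf.expectation (geometric_pmf p) (\<lambda>m. real m * \<phi> m) = suminf a"
      unfolding expec[OF int] a_def ..
    also have "\<dots> = (\<Sum>m. a (Suc m))"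
      using suminf_split_head[OF summable_norm_cancel[OF sm]] by (simp add: a_def)
    also have "\<dots> = (1 - p) * (\<Sum>m. (1 - p) ^ m * p * (real (Suc m) * \<phi> (Suc m)))"
      unfolding a_Suc
      by (rule suminf_mult, rule summable_norm_cancel) (rule int'[OF True, unfolded dens])
    also have "\<dots> = (1 - p) * measure_pmf.expectation (geometric_pmf p) (\<lambda>m. real (Suc m) * \<phi> (Suc m))"
      by (simp only: expec[OF int'[OF True]])
    finally show ?thesis .
  qed (use p in \<open>simp add: order_class.order.antisym not_less\<close>)
qed

text \<open>Write \<open>m + 1\<close> as a sum in the size-bias identity. The term with \<open>m\<close> is of second order in \<open>1 - p\<close>,
  because the mean of the geometric law is \<open>(1 - p) / p\<close>.\<close>

lemma geometric_size_bias_approx: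
  fixes \<phi> :: "nat \<Rightarrow> real"
  assumes p: "p \<in> {0<..<1}" and bnd: "\<And>m. \<bar>\<phi> m\<bar> \<le> B"
  shows "\<bar>measure_pmf.expectation (geometric_pmf p) (\<lambda>m. real m * \<phi> m) -
           (1 - p) * measure_pmf.expectation (geometric_pmf p) (\<lambda>m. \<phi> (Suc m))\<bar>
         \<le> B * (1 - p) ^ 2 / p"
proof -
  have p': "p \<in> {0<..1}" using p by auto
  note int1 = integrable_real_geometric_pmf[OF p']
  have int: "integrable (geometric_pmf p) (\<lambda>m. real m * \<psi> m)" if "\<And>m. \<bar>\<psi> m\<bar> \<le> B" for \<psi>
  proof (rule Bochner_Integration.integrable_bound)
    show "integrable (geometric_pmf p) (\<lambda>m. B * real m)" using int1 by simp
    show "AE m in geometric_pmf p. norm (real m * \<psi> m) \<le> norm (B * real m)"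
    proof (rule AE_I2)
      fix m
      have "real m * \<bar>\<psi> m\<bar> \<le> real m * \<bar>B\<bar>"
        using that[of m] by (intro mult_left_mono) auto
      thus "norm (real m * \<psi> m) \<le> norm (B * real m)" by (simp add: abs_mult mult.commute)
    qed
  qed simp
  have intS: "integrable (geometric_pmf p) (\<lambda>m. real m * \<phi> (Suc m))" by (rule int) (rule bnd)
  have intb: "integrable (geometric_pmf p) (\<lambda>m. \<phi> (Suc m))"
    by (rule measure_pmf.integrable_const_bound[where B = B]) (auto simp: bnd)
  have "measure_pmf.expectation (geometric_pmf p) (\<lambda>m. real m * \<phi> m) =
      (1 - p) * measure_pmf.expectation (geometric_pmf p) (\<lambda>m. real m * \<phi> (Suc m) + \<phi> (Suc m))"
    by (subst expectation_geometric_size_bias[OF p' int[OF bnd]]) (simp add: algebra_simps)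
  also have "\<dots> = (1 - p) * measure_pmf.expectation (geometric_pmf p) (\<lambda>m. real m * \<phi> (Suc m)) +
      (1 - p) * measure_pmf.expectation (geometric_pmf p) (\<lambda>m. \<phi> (Suc m))"
    using intS intb by (simp add: algebra_simps)
  finally have "\<bar>measure_pmf.expectation (geometric_pmf p) (\<lambda>m. real m * \<phi> m) -
           (1 - p) * measure_pmf.expectation (geometric_pmf p) (\<lambda>m. \<phi> (Suc m))\<bar> =
       (1 - p) * \<bar>measure_pmf.expectation (geometric_pmf p) (\<lambda>m. real m * \<phi> (Suc m))\<bar>"
    using p by (simp add: abs_mult)
  also have "\<bar>measure_pmf.expectation (geometric_pmf p) (\<lambda>m. real m * \<phi> (Suc m))\<bar> \<le>
      measure_pmf.expectation (geometric_pmf p) (\<lambda>m. B * real m)"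
  proof (rule order_trans[OF integral_abs_bound integral_mono])
    fix m
    show "\<bar>real m * \<phi> (Suc m)\<bar> \<le> B * real m"
      using mult_left_mono[OF bnd[of "Suc m"], of "real m"] by (simp add: abs_mult mult.commute)
  qed (use intS int1 in auto)
  also have "\<dots> = B * ((1 - p) / p)" using expectation_geometric_pmf[OF p'] by simp
  finally show "\<bar>measure_pmf.expectation (geometric_pmf p) (\<lambda>m. real m * \<phi> m) -
           (1 - p) * measure_pmf.expectation (geometric_pmf p) (\<lambda>m. \<phi> (Suc m))\<bar>
         \<le> B * (1 - p) ^ 2 / p"
    using p by (simp add: power2_eq_square mult_ac)
qed

lemma (in prob_space) indep_expectation:
  fixes X Z :: "'a \<Rightarrow> real" and f :: "real \<Rightarrow> real \<Rightarrow> real"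
  assumes indep: "indep_var borel X borel Z"
    and law: "distr M borel X = distr (measure_pmf q) borel real"
    and f [measurable]: "case_prod f \<in> borel_measurable (borel \<Otimes>\<^sub>M borel)"
    and int: "integrable M (\<lambda>\<omega>. f (X \<omega>) (Z \<omega>))"
  shows "expectation (\<lambda>\<omega>. f (X \<omega>) (Z \<omega>)) =
           measure_pmf.expectation q (\<lambda>m. expectation (\<lambda>\<omega>. f (real m) (Z \<omega>)))"
proof -
  have rv [measurable]: "random_variable borel X" "random_variable borel Z"
    and eq: "distr M borel X \<Otimes>\<^sub>M distr M borel Z = distr M (borel \<Otimes>\<^sub>M borel) (\<lambda>x. (X x, Z x))"
    using indep unfolding indep_var_distribution_eq by auto
  interpret X: prob_space "distr M borel X" by (rule prob_space_distr) simp
  interpret Z: prob_space "distr M borel Z" by (rule prob_space_distr) simp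
  interpret P: pair_sigma_finite "distr M borel X" "distr M borel Z" ..
  have int': "integrable (distr M borel X \<Otimes>\<^sub>M distr M borel Z) (case_prod f)"
    unfolding eq using int by (subst integrable_distr_eq) auto
  have "expectation (\<lambda>\<omega>. f (X \<omega>) (Z \<omega>)) =
      integral\<^sup>L (distr M borel X \<Otimes>\<^sub>M distr M borel Z) (case_prod f)"
    unfolding eq by (subst integral_distr) auto
  also have "\<dots> = (\<integral>x. (\<integral>z. f x z \<partial>distr M borel Z) \<partial>distr M borel X)"
    using P.integral_fst[OF int'] by simp
  also have "\<dots> = (\<integral>x. expectation (\<lambda>\<omega>. f x (Z \<omega>)) \<partial>distr M borel X)"
    by (intro Bochner_Integration.integral_cong refl integral_distr) auto
  also have "\<dots> = measure_pmf.expectation q (\<lambda>m. expectation (\<lambda>\<omega>. f (real m) (Z \<omega>)))"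
    unfolding law by (subst integral_distr) auto
  finally show ?thesis .
qed

text \<open>Conditioning on the independent part \<open>Z\<close> reduces this to the one-variable estimate.\<close>

lemma (in prob_space) geometric_summand_approx:
  fixes X Z :: "'a \<Rightarrow> real" and g :: "real \<Rightarrow> real"
  assumes indep: "indep_var borel X borel Z"
    and p: "p \<in> {0<..<1}"
    and law: "distr M borel X = distr (measure_pmf (geometric_pmf p)) borel real"
    and g [measurable]: "g \<in> borel_measurable borel" and bnd: "\<And>x. \<bar>g x\<bar> \<le> B"
  shows "\<bar>expectation (\<lambda>\<omega>. X \<omega> * g (a * X \<omega> + Z \<omega>)) -
      (1 - p) * expectation (\<lambda>\<omega>. g (a * (X \<omega> + 1) + Z \<omega>))\<bar> \<le> B * (1 - p) ^ 2 / p"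
proof -
  have rv [measurable]: "random_variable borel X" "random_variable borel Z"
    using indep unfolding indep_var_distribution_eq by auto
  have "integrable (distr M borel X) (\<lambda>x. x)"
    unfolding law using p by (subst integrable_distr_eq) (auto intro: integrable_real_geometric_pmf)
  hence intX: "integrable M X" by (subst (asm) integrable_distr_eq) auto
  have int1: "integrable M (\<lambda>\<omega>. X \<omega> * g (a * X \<omega> + Z \<omega>))"
  proof (rule Bochner_Integration.integrable_bound)
    show "integrable M (\<lambda>\<omega>. B * X \<omega>)" using intX by simp
    show "AE \<omega> in M. norm (X \<omega> * g (a * X \<omega> + Z \<omega>)) \<le> norm (B * X \<omega>)"
    proof (rule AE_I2)
      fix \<omega>
      have "\<bar>X \<omega>\<bar> * \<bar>g (a * X \<omega> + Z \<omega>)\<bar> \<le> \<bar>X \<omega>\<bar> * \<bar>B\<bar>"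
        using bnd[of "a * X \<omega> + Z \<omega>"] by (intro mult_left_mono) auto
      thus "norm (X \<omega> * g (a * X \<omega> + Z \<omega>)) \<le> norm (B * X \<omega>)" by (simp add: abs_mult mult.commute)
    qed
  qed measurable
  define \<phi> where "\<phi> = (\<lambda>m::nat. expectation (\<lambda>\<omega>. g (a * real m + Z \<omega>)))"
  have intg: "integrable M (\<lambda>\<omega>. g (a * x + Z \<omega>))" for x
    by (rule integrable_const_bound[where B = B]) (auto simp: bnd)
  have "\<bar>\<phi> m\<bar> \<le> B" for m
  proof -
    have "\<bar>\<phi> m\<bar> \<le> expectation (\<lambda>_. B)" unfolding \<phi>_def
      by (rule order_trans[OF integral_abs_bound integral_mono]) (use intg bnd in auto)
    thus ?thesis by (simp add: prob_space)
  qed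
  note * = geometric_size_bias_approx[OF p this]
  have "expectation (\<lambda>\<omega>. X \<omega> * g (a * X \<omega> + Z \<omega>)) =
      measure_pmf.expectation (geometric_pmf p) (\<lambda>m. expectation (\<lambda>\<omega>. real m * g (a * real m + Z \<omega>)))"
    by (rule indep_expectation[where f = "\<lambda>x z. x * g (a * x + z)", OF indep law _ int1])
       (simp add: case_prod_unfold)
  also have "\<dots> = measure_pmf.expectation (geometric_pmf p) (\<lambda>m. real m * \<phi> m)"
    by (simp add: \<phi>_def)
  finally have 1: "expectation (\<lambda>\<omega>. X \<omega> * g (a * X \<omega> + Z \<omega>)) =
    measure_pmf.expectation (geometric_pmf p) (\<lambda>m. real m * \<phi> m)" .
  have int2: "integrable M (\<lambda>\<omega>. g (a * (X \<omega> + 1) + Z \<omega>))"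
    by (rule integrable_const_bound[where B = B]) (auto simp: bnd)
  have "expectation (\<lambda>\<omega>. g (a * (X \<omega> + 1) + Z \<omega>)) =
      measure_pmf.expectation (geometric_pmf p) (\<lambda>m. expectation (\<lambda>\<omega>. g (a * (real m + 1) + Z \<omega>)))"
    by (rule indep_expectation[where f = "\<lambda>x z. g (a * (x + 1) + z)", OF indep law _ int2])
       (simp add: case_prod_unfold)
  also have "\<dots> = measure_pmf.expectation (geometric_pmf p) (\<lambda>m. \<phi> (Suc m))"
    by (simp add: \<phi>_def add.commute)
  finally have 2: "expectation (\<lambda>\<omega>. g (a * (X \<omega> + 1) + Z \<omega>)) =
    measure_pmf.expectation (geometric_pmf p) (\<lambda>m. \<phi> (Suc m))" .
  show "\<bar>expectation (\<lambda>\<omega>. X \<omega> * g (a * X \<omega> + Z \<omega>)) -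
      (1 - p) * expectation (\<lambda>\<omega>. g (a * (X \<omega> + 1) + Z \<omega>))\<bar> \<le> B * (1 - p) ^ 2 / p"
    unfolding 1 2 by (rule *)
qed

section \<open>The normalised prime sum and its distance to the Dickman law\<close>

definition stein_const :: real where
  "stein_const = 1 / 2 * ln_square_sum + (mertens_const * (1 / 2 + 1 / 3) + 1 / 3 * (1 + 2 * mertens_const))"

locale prime_geometric =
  fixes M :: "'a measure" and X :: "nat \<Rightarrow> 'a \<Rightarrow> nat" and n :: nat
  assumes XM: "indep_prime_geometric M X" and n: "n \<ge> 1"
begin

sublocale prob_space M using XM by (simp add: indep_prime_geometric_def)

definition L :: real where "L = ln (real (nth_prime n))"
definition a :: "nat \<Rightarrow> real" where "a k = ln (real (nth_prime k)) / L"
abbreviation S :: "'a \<Rightarrow> real" where "S \<equiv> prime_geometric_sum X n"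

lemma L_pos: "L > 0"
  using nth_prime_gt[OF n] n by (simp add: L_def)

lemma a_nonneg: "a k \<ge> 0"
  using L_pos ln_real_nat_nonneg[of "nth_prime k"] by (simp add: a_def)

lemma S_eq: "S \<omega> = (\<Sum>k=1..n. a k * real (X k \<omega>))"
  unfolding prime_geometric_sum_def a_def L_def sum_distrib_left
  by (intro sum.cong) auto

lemma S_nonneg: "S \<omega> \<ge> 0"
  unfolding S_eq by (intro sum_nonneg mult_nonneg_nonneg a_nonneg) auto

lemma indep_X: "indep_vars (\<lambda>_. count_space UNIV) X {1..}"
  using XM by (simp add: indep_prime_geometric_def)

lemma X_measurable [measurable]: "k \<ge> 1 \<Longrightarrow> X k \<in> measurable M (count_space UNIV)"
  using indep_X unfolding indep_vars_def by auto

lemma S_measurable [measurable]: "S \<in> borel_measurable M"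
proof -
  have "(\<lambda>\<omega>. \<Sum>k=1..n. a k * real (X k \<omega>)) \<in> borel_measurable M"
  proof (rule borel_measurable_sum)
    fix k assume "k \<in> {1..n}"
    hence [measurable]: "X k \<in> measurable M (count_space UNIV)" by (intro X_measurable) auto
    show "(\<lambda>\<omega>. a k * real (X k \<omega>)) \<in> borel_measurable M" by measurable
  qed
  thus ?thesis by (simp add: S_eq [abs_def])
qed

lemma law_X:
  assumes "k \<ge> 1"
  shows "distr M borel (\<lambda>\<omega>. real (X k \<omega>)) =
    distr (measure_pmf (geometric_pmf (1 - 1 / real (nth_prime k)))) borel real"
proof -
  have "distr M (count_space UNIV) (X k) = measure_pmf (geometric_pmf (1 - 1 / real (nth_prime k)))"
    using XM assms by (simp add: indep_prime_geometric_def)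
  moreover have "distr (distr M (count_space UNIV) (X k)) borel real = distr M borel (real \<circ> X k)"
    using assms by (intro distr_distr) auto
  ultimately show ?thesis by (simp add: comp_def)
qed

lemma prime_param: "1 - 1 / real (nth_prime k) \<in> {0<..<1}"
  using prime_ge_2_nat[OF nth_prime_prime[of k]] by (auto simp: field_simps)

definition rest :: "nat \<Rightarrow> 'a \<Rightarrow> real" where
  "rest k \<omega> = (\<Sum>j\<in>{1..n}-{k}. a j * real (X j \<omega>))"

lemma S_split: "k \<in> {1..n} \<Longrightarrow> S \<omega> = a k * real (X k \<omega>) + rest k \<omega>"
  unfolding S_eq rest_def by (rule sum.remove) auto

text \<open>Only the summands with index different from \<open>k\<close> are scaled, so that \<open>X k\<close> itself is kept
  geometric.\<close>

lemma indep_rest: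
  assumes k: "k \<in> {1..n}"
  shows "indep_var borel (\<lambda>\<omega>. real (X k \<omega>)) borel (rest k)"
proof -
  define Y where "Y = (\<lambda>j (x::nat). if j = k then real x else a j * real x)"
  have "indep_vars (\<lambda>_. borel) (\<lambda>j \<omega>. Y j (X j \<omega>)) (insert k ({1..n} - {k}))"
    by (rule indep_vars_compose2[OF indep_vars_subset[OF indep_X]]) (use k in \<open>auto simp: Y_def\<close>)
  hence "indep_var borel (\<lambda>\<omega>. Y k (X k \<omega>)) borel (\<lambda>\<omega>. \<Sum>j\<in>{1..n}-{k}. Y j (X j \<omega>))"
    by (intro indep_vars_sum) auto
  moreover have "(\<lambda>\<omega>. \<Sum>j\<in>{1..n}-{k}. Y j (X j \<omega>)) = rest k"
    unfolding rest_def by (intro ext sum.cong) (auto simp: Y_def)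
  ultimately show ?thesis by (simp add: Y_def)
qed

lemma integrable_X: "k \<ge> 1 \<Longrightarrow> integrable M (\<lambda>\<omega>. real (X k \<omega>))"
  and expectation_X: "k \<ge> 1 \<Longrightarrow> expectation (\<lambda>\<omega>. real (X k \<omega>)) = 1 / (real (nth_prime k) - 1)"
proof -
  assume k: "k \<ge> 1"
  note [measurable] = X_measurable[OF k]
  let ?p = "1 - 1 / real (nth_prime k)"
  have p: "?p \<in> {0<..1}" using prime_param[of k] by auto
  have "integrable (distr M borel (\<lambda>\<omega>. real (X k \<omega>))) (\<lambda>x. x)"
    unfolding law_X[OF k] by (subst integrable_distr_eq) (auto intro: integrable_real_geometric_pmf[OF p])
  thus "integrable M (\<lambda>\<omega>. real (X k \<omega>))" by (subst (asm) integrable_distr_eq) auto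
  have "expectation (\<lambda>\<omega>. real (X k \<omega>)) = integral\<^sup>L (distr M borel (\<lambda>\<omega>. real (X k \<omega>))) (\<lambda>x. x)"
    by (subst integral_distr) auto
  also have "\<dots> = measure_pmf.expectation (geometric_pmf ?p) real"
    unfolding law_X[OF k] by (subst integral_distr) auto
  also have "\<dots> = (1 - ?p) / ?p" by (rule expectation_geometric_pmf[OF p])
  also have "\<dots> = 1 / (real (nth_prime k) - 1)"
    using prime_ge_2_nat[OF nth_prime_prime[of k]] by (simp add: field_simps)
  finally show "expectation (\<lambda>\<omega>. real (X k \<omega>)) = 1 / (real (nth_prime k) - 1)" .
qed

lemma integrable_S: "integrable M S"
proof -
  have "integrable M (\<lambda>\<omega>. \<Sum>k=1..n. a k * real (X k \<omega>))"
    by (intro Bochner_Integration.integrable_sum integrable_mult_right integrable_X) auto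
  thus ?thesis by (simp add: S_eq [abs_def])
qed

lemma expectation_S: "expectation S = prime_weight (nth_prime n) / L"
proof -
  have "expectation S = (\<Sum>k=1..n. a k * expectation (\<lambda>\<omega>. real (X k \<omega>)))"
    unfolding S_eq [abs_def]
    by (subst Bochner_Integration.integral_sum) (auto intro!: integrable_mult_right integrable_X)
  also have "\<dots> = (\<Sum>k=1..n. ln (nth_prime k) / (real (nth_prime k) - 1)) / L"
    unfolding sum_divide_distrib by (intro sum.cong) (auto simp: expectation_X a_def)
  also have "(\<Sum>k=1..n. ln (nth_prime k) / (real (nth_prime k) - 1)) = prime_weight (nth_prime n)"
    unfolding prime_weight_def by (rule sum_nth_prime[OF n])
  finally show ?thesis .
qed

text \<open>Sum the estimates for the single geometric variables. The second-order terms add up to at most a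
  multiple of \<open>(\<Sum>p. ln p / (p (p - 1))) / L\<close>, a convergent series over \<open>L\<close>.\<close>

lemma size_bias_S:
  fixes g :: "real \<Rightarrow> real"
  assumes g [measurable]: "g \<in> borel_measurable borel" and bnd: "\<And>x. \<bar>g x\<bar> \<le> B"
  shows "\<bar>expectation (\<lambda>\<omega>. S \<omega> * g (S \<omega>)) -
      (\<Sum>k=1..n. a k / nth_prime k * expectation (\<lambda>\<omega>. g (S \<omega> + a k)))\<bar> \<le> B * ln_square_sum / L"
proof -
  have B: "B \<ge> 0" using bnd[of 0] by linarith
  have int: "integrable M (\<lambda>\<omega>. real (X k \<omega>) * g (S \<omega>))" if "k \<ge> 1" for k
  proof (rule Bochner_Integration.integrable_bound)
    show "integrable M (\<lambda>\<omega>. B * real (X k \<omega>))" using integrable_X[OF that] by simp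
    show "AE \<omega> in M. norm (real (X k \<omega>) * g (S \<omega>)) \<le> norm (B * real (X k \<omega>))"
    proof (rule AE_I2)
      fix \<omega>
      have "real (X k \<omega>) * \<bar>g (S \<omega>)\<bar> \<le> real (X k \<omega>) * B" by (intro mult_left_mono bnd) auto
      thus "norm (real (X k \<omega>) * g (S \<omega>)) \<le> norm (B * real (X k \<omega>))"
        using B by (simp add: abs_mult mult.commute)
    qed
  next
    note [measurable] = X_measurable[OF that]
    show "(\<lambda>\<omega>. real (X k \<omega>) * g (S \<omega>)) \<in> borel_measurable M" by measurable
  qed
  have summand: "\<bar>a k * expectation (\<lambda>\<omega>. real (X k \<omega>) * g (S \<omega>)) -
      a k / nth_prime k * expectation (\<lambda>\<omega>. g (S \<omega> + a k))\<bar> \<le>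
      B / L * (ln (nth_prime k) / (real (nth_prime k) * (real (nth_prime k) - 1)))"
    if k: "k \<in> {1..n}" for k
  proof -
    define p where "p = real (nth_prime k)"
    have p: "p \<ge> 2" using prime_ge_2_nat[OF nth_prime_prime[of k]] by (simp add: p_def)
    have k1: "k \<ge> 1" using k by simp
    have "\<bar>expectation (\<lambda>\<omega>. real (X k \<omega>) * g (a k * real (X k \<omega>) + rest k \<omega>)) -
      (1 - (1 - 1 / p)) * expectation (\<lambda>\<omega>. g (a k * (real (X k \<omega>) + 1) + rest k \<omega>))\<bar>
      \<le> B * (1 - (1 - 1 / p)) ^ 2 / (1 - 1 / p)"
      unfolding p_def
      by (rule geometric_summand_approx[OF indep_rest[OF k] prime_param law_X[OF k1] g bnd])
    also have "(\<lambda>\<omega>. g (a k * (real (X k \<omega>) + 1) + rest k \<omega>)) = (\<lambda>\<omega>. g (S \<omega> + a k))"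
      by (simp add: S_split[OF k] algebra_simps)
    also have "(\<lambda>\<omega>. real (X k \<omega>) * g (a k * real (X k \<omega>) + rest k \<omega>)) = (\<lambda>\<omega>. real (X k \<omega>) * g (S \<omega>))"
      by (simp add: S_split[OF k])
    also have "B * (1 - (1 - 1 / p)) ^ 2 / (1 - 1 / p) = B / (p * (p - 1))"
      using p by (simp add: field_simps power2_eq_square)
    finally have *: "\<bar>expectation (\<lambda>\<omega>. real (X k \<omega>) * g (S \<omega>)) - 1 / p * expectation (\<lambda>\<omega>. g (S \<omega> + a k))\<bar>
        \<le> B / (p * (p - 1))" by simp
    have "a k * \<bar>expectation (\<lambda>\<omega>. real (X k \<omega>) * g (S \<omega>)) - 1 / p * expectation (\<lambda>\<omega>. g (S \<omega> + a k))\<bar>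
       \<le> a k * (B / (p * (p - 1)))"
      by (rule mult_left_mono[OF * a_nonneg])
    also have "a k * (B / (p * (p - 1))) = B / L * (ln p / (p * (p - 1)))"
      by (simp add: a_def p_def)
    also have "a k * \<bar>expectation (\<lambda>\<omega>. real (X k \<omega>) * g (S \<omega>)) - 1 / p * expectation (\<lambda>\<omega>. g (S \<omega> + a k))\<bar>
      = \<bar>a k * (expectation (\<lambda>\<omega>. real (X k \<omega>) * g (S \<omega>)) - 1 / p * expectation (\<lambda>\<omega>. g (S \<omega> + a k)))\<bar>"
      using a_nonneg[of k] by (simp add: abs_mult)
    finally show ?thesis unfolding p_def by (simp add: right_diff_distrib)
  qed
  have "expectation (\<lambda>\<omega>. S \<omega> * g (S \<omega>)) = expectation (\<lambda>\<omega>. \<Sum>k=1..n. a k * (real (X k \<omega>) * g (S \<omega>)))"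
    by (intro Bochner_Integration.integral_cong refl, subst (1) S_eq)
       (simp add: sum_distrib_right mult.assoc)
  also have "\<dots> = (\<Sum>k=1..n. a k * expectation (\<lambda>\<omega>. real (X k \<omega>) * g (S \<omega>)))"
    by (subst Bochner_Integration.integral_sum) (auto intro!: integrable_mult_right int)
  finally have "expectation (\<lambda>\<omega>. S \<omega> * g (S \<omega>)) - (\<Sum>k=1..n. a k / nth_prime k * expectation (\<lambda>\<omega>. g (S \<omega> + a k)))
     = (\<Sum>k=1..n. a k * expectation (\<lambda>\<omega>. real (X k \<omega>) * g (S \<omega>)) -
            a k / nth_prime k * expectation (\<lambda>\<omega>. g (S \<omega> + a k)))"
    by (simp add: sum_subtractf)
  also have "\<bar>\<dots>\<bar> \<le> (\<Sum>k=1..n. B / L * (ln (nth_prime k) / (real (nth_prime k) * (real (nth_prime k) - 1))))"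
    by (rule order_trans[OF sum_abs sum_mono]) (rule summand)
  also have "\<dots> = B / L * (\<Sum>p | prime p \<and> p \<le> nth_prime n. ln (real p) / (real p * (real p - 1)))"
    unfolding sum_distrib_left [symmetric] by (subst sum_nth_prime[OF n]) simp
  also have "\<dots> \<le> B / L * ln_square_sum"
    using B L_pos by (intro mult_left_mono sum_primes_le_ln_square_sum prime_correction_le(2)) auto
  finally show ?thesis by simp
qed

lemma integrable_lipschitz_S:
  fixes h :: "real \<Rightarrow> real"
  assumes lip: "1-lipschitz_on {0..} h"
  shows "integrable M (\<lambda>\<omega>. h (S \<omega>))"
proof (rule Bochner_Integration.integrable_bound)
  show "integrable M (\<lambda>\<omega>. \<bar>h 0\<bar> + S \<omega>)" using integrable_S by simp
  note [measurable] = borel_measurable_max0(2)[OF lipschitz_on_continuous_on[OF lip]]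
  have "(\<lambda>\<omega>. h (max 0 (S \<omega>))) \<in> borel_measurable M" by measurable
  thus "(\<lambda>\<omega>. h (S \<omega>)) \<in> borel_measurable M" using S_nonneg by simp
  show "AE \<omega> in M. norm (h (S \<omega>)) \<le> norm (\<bar>h 0\<bar> + S \<omega>)"
  proof (rule AE_I2)
    fix \<omega>
    show "norm (h (S \<omega>)) \<le> norm (\<bar>h 0\<bar> + S \<omega>)"
      using lipschitz_onD[OF lip, of "S \<omega>" 0] S_nonneg[of \<omega>] by (simp add: dist_real_def)
  qed
qed

text \<open>\<open>S\<close> satisfies the Dickman size-bias identity up to \<open>O(1/L)\<close> for the bounded Lipschitz function
  \<open>avg_deriv h'\<close>; by \<open>dickman_generator\<close> this identity measures the change of the expectation of
  \<open>h (S)\<close> under averaging.\<close>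

lemma dickman_defect:
  assumes "H11_function h h'"
  shows "\<bar>expectation (\<lambda>\<omega>. h (S \<omega>)) - expectation (\<lambda>\<omega>. avg h (S \<omega> + 1))\<bar> \<le> stein_const / L"
proof -
  interpret H11_function h h' by fact
  define g where "g = (\<lambda>x. avg_deriv h' (max 0 x))"
  have gS: "g x = avg_deriv h' x" if "x \<ge> 0" for x using that by (simp add: g_def)
  have bnd: "\<bar>g x\<bar> \<le> 1 / 2" for x unfolding g_def by (rule avg_deriv_le) simp
  have [measurable]: "g \<in> borel_measurable borel"
    unfolding g_def by (rule borel_measurable_max0(2)[OF lipschitz_on_continuous_on[OF avg_deriv_lipschitz]])
  define I where "I = (\<lambda>x. integral {0..1} (\<lambda>u. avg_deriv h' (x + u)))"
  have I_eq: "I (S \<omega>) = S \<omega> * g (S \<omega>) - h (S \<omega>) + avg h (S \<omega> + 1)" for \<omega>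
    using dickman_generator[OF S_nonneg[of \<omega>]] S_nonneg[of \<omega>] by (simp add: I_def gS)
  have ih: "integrable M (\<lambda>\<omega>. h (S \<omega>))" by (rule integrable_lipschitz_S[OF lip])
  have "integrable M (\<lambda>\<omega>. 2 * avg h (S \<omega> + 1))"
    by (rule integrable_lipschitz_S[OF H11_lipschitz[OF contraction_in_H11]])
  from integrable_mult_right[OF this, of "1 / 2"]
  have ia: "integrable M (\<lambda>\<omega>. avg h (S \<omega> + 1))" by simp
  have ig: "integrable M (\<lambda>\<omega>. S \<omega> * g (S \<omega>))"
  proof (rule Bochner_Integration.integrable_bound[OF integrable_S])
    show "AE \<omega> in M. norm (S \<omega> * g (S \<omega>)) \<le> norm (S \<omega>)"
    proof (rule AE_I2)
      fix \<omega>
      have "\<bar>S \<omega>\<bar> * \<bar>g (S \<omega>)\<bar> \<le> \<bar>S \<omega>\<bar> * 1"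
        using bnd[of "S \<omega>"] by (intro mult_left_mono) auto
      thus "norm (S \<omega> * g (S \<omega>)) \<le> norm (S \<omega>)" by (simp add: abs_mult)
    qed
  qed measurable
  have iI: "integrable M (\<lambda>\<omega>. I (S \<omega>))"
    unfolding I_eq using ih ia ig by simp
  have EI: "expectation (\<lambda>\<omega>. I (S \<omega>)) =
      expectation (\<lambda>\<omega>. S \<omega> * g (S \<omega>)) - expectation (\<lambda>\<omega>. h (S \<omega>)) + expectation (\<lambda>\<omega>. avg h (S \<omega> + 1))"
    unfolding I_eq using ih ia ig by simp
  define J where "J = (\<lambda>\<omega>. \<Sum>k=1..n. a k / nth_prime k * g (S \<omega> + a k))"
  have igk: "integrable M (\<lambda>\<omega>. g (S \<omega> + a k))" for k
  proof (rule integrable_const_bound)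
    show "AE \<omega> in M. norm (g (S \<omega> + a k)) \<le> 1 / 2" by (rule AE_I2) (simp only: real_norm_def bnd)
  qed measurable
  have iJ: "integrable M J" unfolding J_def using igk by simp
  have EJ: "expectation J = (\<Sum>k=1..n. a k / nth_prime k * expectation (\<lambda>\<omega>. g (S \<omega> + a k)))"
    unfolding J_def using igk by (subst Bochner_Integration.integral_sum) auto
  define K where "K = mertens_const * (1 / 2 + 1 / 3) + 1 / 3 * (1 + 2 * mertens_const)"
  have pw: "\<bar>J \<omega> - I (S \<omega>)\<bar> \<le> K / L" for \<omega>
  proof -
    have "\<bar>(\<Sum>k=1..n. ln (nth_prime k) / (L * nth_prime k) * avg_deriv h' (S \<omega> + ln (nth_prime k) / L))
            - integral {0..1} (\<lambda>u. avg_deriv h' (S \<omega> + u))\<bar> \<le> K / L"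
      unfolding K_def L_def
      by (rule prime_sum_approx_integral[OF n S_nonneg avg_deriv_le avg_deriv_lipschitz])
    also have "(\<Sum>k=1..n. ln (nth_prime k) / (L * nth_prime k) * avg_deriv h' (S \<omega> + ln (nth_prime k) / L)) = J \<omega>"
      unfolding J_def
    proof (intro sum.cong refl)
      fix k
      have "g (S \<omega> + a k) = avg_deriv h' (S \<omega> + a k)"
        by (intro gS add_nonneg_nonneg S_nonneg a_nonneg)
      thus "ln (nth_prime k) / (L * nth_prime k) * avg_deriv h' (S \<omega> + ln (nth_prime k) / L) =
          a k / nth_prime k * g (S \<omega> + a k)"
        by (simp add: a_def)
    qed
    finally show ?thesis unfolding I_def .
  qed
  have "\<bar>expectation J - expectation (\<lambda>\<omega>. I (S \<omega>))\<bar> = \<bar>expectation (\<lambda>\<omega>. J \<omega> - I (S \<omega>))\<bar>"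
    using iJ iI by simp
  also have "\<dots> \<le> expectation (\<lambda>_. K / L)"
    by (rule order_trans[OF integral_abs_bound integral_mono]) (use iJ iI pw in auto)
  finally have 1: "\<bar>expectation J - expectation (\<lambda>\<omega>. I (S \<omega>))\<bar> \<le> K / L" by (simp add: prob_space)
  have 2: "\<bar>expectation (\<lambda>\<omega>. S \<omega> * g (S \<omega>)) - expectation J\<bar> \<le> 1 / 2 * ln_square_sum / L"
    unfolding EJ by (rule size_bias_S[OF _ bnd]) measurable
  have "stein_const / L = 1 / 2 * ln_square_sum / L + K / L"
    by (simp add: stein_const_def K_def add_divide_distrib)
  thus ?thesis using 1 2 EI by linarith
qed

end

lemma set_integral_nonneg_law:
  fixes h :: "real \<Rightarrow> real"
  assumes sets: "sets \<mu> = sets borel" and nonneg: "AE w in \<mu>. 0 \<le> w" and h: "continuous_on {0..} h"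
  shows "(LINT x:{0..}|\<mu>. h x) = (LINT x|\<mu>. h (max 0 x))"
proof -
  note [measurable] = borel_measurable_max0(2)[OF h]
  note [measurable_cong] = sets
  have "(LINT x:{0..}|\<mu>. h x) = (LINT x|\<mu>. indicator {0..} x * h (max 0 x))"
    unfolding set_lebesgue_integral_def
    by (intro Bochner_Integration.integral_cong) (auto simp: indicator_def)
  also have "\<dots> = (LINT x|\<mu>. h (max 0 x))"
  proof (rule integral_cong_AE)
    show "AE x in \<mu>. indicator {0..} x * h (max 0 x) = h (max 0 x)"
      using nonneg by eventually_elim simp
  qed measurable
  finally show ?thesis .
qed

locale dickman_approx = prime_geometric M X n + D: dickman_law \<mu>
  for M :: "'a measure" and X n and \<mu> :: "real measure"
begin

definition discrepancy :: "(real \<Rightarrow> real) \<Rightarrow> real" where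
  "discrepancy h = D.expectation (\<lambda>w. h (max 0 w)) - expectation (\<lambda>\<omega>. h (S \<omega>))"

lemma discrepancy_eq:
  fixes h :: "real \<Rightarrow> real"
  assumes "continuous_on {0..} h"
  shows "(LINT x:{0..}|\<mu>. h x) - (LINT x:{0..}|distr M borel S. h x) = discrepancy h"
proof -
  have "(LINT x:{0..}|distr M borel S. h x) = (LINT x|distr M borel S. h (max 0 x))"
    by (rule set_integral_nonneg_law) (use assms S_nonneg in \<open>auto simp: AE_distr_iff\<close>)
  also have "\<dots> = expectation (\<lambda>\<omega>. h (max 0 (S \<omega>)))"
    by (rule integral_distr) (use borel_measurable_max0(2)[OF assms] in auto)
  also have "\<dots> = expectation (\<lambda>\<omega>. h (S \<omega>))" using S_nonneg by simp
  finally show ?thesis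
    unfolding discrepancy_def set_integral_nonneg_law[OF D.sets_mu D.nonneg assms] by simp
qed

lemma discrepancy_contract:
  assumes "h \<in> H11"
  shows "\<exists>k\<in>H11. \<bar>discrepancy h\<bar> \<le> stein_const / L + \<bar>discrepancy k\<bar> / 2"
proof -
  from assms obtain h' where h': "H11_function h h'" by (rule H11_obtain)
  interpret H11_function h h' by fact
  have "discrepancy (\<lambda>x. 2 * avg h (x + 1)) =
     2 * (D.expectation (\<lambda>w. avg h (max 0 w + 1)) - expectation (\<lambda>\<omega>. avg h (S \<omega> + 1)))"
    by (simp add: discrepancy_def)
  hence "\<bar>discrepancy (\<lambda>x. 2 * avg h (x + 1))\<bar> / 2 =
     \<bar>D.expectation (\<lambda>w. avg h (max 0 w + 1)) - expectation (\<lambda>\<omega>. avg h (S \<omega> + 1))\<bar>"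
    by (simp only: abs_mult abs_numeral, simp)
  hence "\<bar>discrepancy h\<bar> \<le> stein_const / L + \<bar>discrepancy (\<lambda>x. 2 * avg h (x + 1))\<bar> / 2"
    using dickman_defect[OF h'] D.expectation_avg[OF h'] unfolding discrepancy_def by linarith
  thus ?thesis using contraction_in_H11 by blast
qed

lemma discrepancy_bounded:
  assumes "h \<in> H11"
  shows "\<bar>discrepancy h\<bar> \<le> 1 + expectation S"
proof -
  note lip = H11_lipschitz[OF assms]
  have "\<bar>D.expectation (\<lambda>w. h (max 0 w)) - h 0\<bar> \<le> 1"
  proof -
    have "D.expectation (\<lambda>w. h (max 0 w)) - h 0 = D.expectation (\<lambda>w. h (max 0 w) - h 0)"
      using D.integrable_H11[OF lip] by (simp add: D.prob_space)
    also have "\<bar>\<dots>\<bar> \<le> D.expectation (\<lambda>w. w)"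
    proof (rule order_trans[OF integral_abs_bound integral_mono_AE])
      show "AE w in \<mu>. \<bar>h (max 0 w) - h 0\<bar> \<le> w"
        using D.nonneg
      proof eventually_elim
        case (elim w)
        thus ?case using lipschitz_onD[OF lip, of w 0] by (simp add: dist_real_def)
      qed
    qed (use D.integrable_H11[OF lip] D.integrable_id in auto)
    finally show ?thesis by (simp add: D.expectation_id)
  qed
  moreover have "\<bar>expectation (\<lambda>\<omega>. h (S \<omega>)) - h 0\<bar> \<le> expectation S"
  proof -
    have "expectation (\<lambda>\<omega>. h (S \<omega>)) - h 0 = expectation (\<lambda>\<omega>. h (S \<omega>) - h 0)"
      using integrable_lipschitz_S[OF lip] by (simp add: prob_space)
    also have "\<bar>\<dots>\<bar> \<le> expectation S"
    proof (rule order_trans[OF integral_abs_bound integral_mono])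
      fix \<omega>
      show "\<bar>h (S \<omega>) - h 0\<bar> \<le> S \<omega>"
        using lipschitz_onD[OF lip, of "S \<omega>" 0] S_nonneg[of \<omega>] by (simp add: dist_real_def)
    qed (use integrable_lipschitz_S[OF lip] integrable_S in auto)
    finally show ?thesis .
  qed
  ultimately show ?thesis unfolding discrepancy_def by linarith
qed

text \<open>Each application of the contraction costs \<open>stein_const / L\<close> and halves what remains, so the total
  cost is a geometric series. The a priori bound by the means makes the remainder vanish.\<close>

lemma discrepancy_le:
  assumes "h \<in> H11"
  shows "\<bar>discrepancy h\<bar> \<le> 2 * stein_const / L"
proof -
  define B where "B = 1 + expectation S"
  have "\<forall>h\<in>H11. \<bar>discrepancy h\<bar> \<le> 2 * stein_const / L + (1 / 2) ^ j * B" for j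
  proof (induction j)
    case 0
    have "stein_const \<ge> 0"
      using ln_square_sum_nonneg by (simp add: stein_const_def mertens_const_def)
    hence "2 * stein_const / L \<ge> 0" using L_pos by simp
    thus ?case using discrepancy_bounded by (fastforce simp: B_def)
  next
    case (Suc j)
    show ?case
    proof
      fix h assume "h \<in> H11"
      then obtain k where "k \<in> H11" "\<bar>discrepancy h\<bar> \<le> stein_const / L + \<bar>discrepancy k\<bar> / 2"
        using discrepancy_contract by blast
      moreover from this have "\<bar>discrepancy k\<bar> \<le> 2 * stein_const / L + (1 / 2) ^ j * B"
        using Suc by blast
      ultimately show "\<bar>discrepancy h\<bar> \<le> 2 * stein_const / L + (1 / 2) ^ Suc j * B"
        by simp
    qed
  qed
  hence le: "\<bar>discrepancy h\<bar> \<le> 2 * stein_const / L + (1 / 2) ^ j * B" for j using assms by blast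
  have "(\<lambda>j. 2 * stein_const / L + (1 / 2) ^ j * B) \<longlonglongrightarrow> 2 * stein_const / L + 0 * B"
    by (intro tendsto_intros LIMSEQ_power_zero) simp
  hence "(\<lambda>j. 2 * stein_const / L + (1 / 2) ^ j * B) \<longlonglongrightarrow> 2 * stein_const / L" by simp
  thus ?thesis using le by (intro LIMSEQ_le_const) auto
qed

lemma d11_le: "d11 (distr M borel S) \<mu> \<le> ereal (2 * stein_const / L)"
  unfolding d11_def
proof (rule SUP_least)
  fix h assume h: "h \<in> H11"
  show "ereal \<bar>(LINT x:{0..}|\<mu>. h x) - (LINT x:{0..}|distr M borel S. h x)\<bar> \<le> ereal (2 * stein_const / L)"
    unfolding discrepancy_eq[OF lipschitz_on_continuous_on[OF H11_lipschitz[OF h]]]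
    using discrepancy_le[OF h] by simp
qed

text \<open>The identity is an admissible test function, and it compares the means \<open>1\<close> and
  \<open>prime_weight p\<^sub>n / L\<close>.\<close>

lemma d11_ge: "d11 (distr M borel S) \<mu> \<ge> ereal ((L - prime_weight (nth_prime n)) / L)"
proof -
  have id: "(\<lambda>x. x) \<in> H11"
    unfolding H11_def
    by (auto intro!: exI[of _ "\<lambda>_. 1"] lipschitz_onI derivative_eq_intros)
  have "D.expectation (\<lambda>w. max 0 w) = D.expectation (\<lambda>w. w)"
  proof (rule integral_cong_AE)
    show "AE w in \<mu>. max 0 w = w" using D.nonneg by eventually_elim simp
  qed auto
  hence "discrepancy (\<lambda>x. x) = 1 - prime_weight (nth_prime n) / L"
    by (simp add: discrepancy_def D.expectation_id expectation_S)
  hence "(L - prime_weight (nth_prime n)) / L = discrepancy (\<lambda>x. x)"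
    using L_pos by (simp add: diff_divide_distrib)
  hence "ereal ((L - prime_weight (nth_prime n)) / L) \<le> ereal \<bar>discrepancy (\<lambda>x. x)\<bar>" by simp
  also have "\<dots> = ereal \<bar>(LINT x:{0..}|\<mu>. x) - (LINT x:{0..}|distr M borel S. x)\<bar>"
    by (subst discrepancy_eq) (auto intro: continuous_intros)
  also have "\<dots> \<le> d11 (distr M borel S) \<mu>"
    unfolding d11_def by (rule SUP_upper2[OF id]) simp
  finally show ?thesis .
qed

end

theorem theorem1p3:
  "\<exists>C c :: real. \<exists>n0 :: nat. c > 0 \<and>
     (\<forall>(M :: 'a measure) X (N :: 'b measure) D.
        indep_prime_geometric M X \<longrightarrow> standard_dickman N D \<longrightarrow>
          (\<forall>n\<ge>2. d11 (distr M borel (prime_geometric_sum X n)) (distr N borel D)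
                    \<le> ereal (C / ln (real n))) \<and>
          (\<forall>n\<ge>n0. d11 (distr M borel (prime_geometric_sum X n)) (distr N borel D)
                    \<ge> ereal (c / ln (real n))))"
proof -
  define C where "C = 2 * stein_const"
  define A where "A = 2 * mertens_const + 4"
  define c where "c = 0.01 / A"
  have pos: "stein_const \<ge> 0" "mertens_const \<ge> 0"
    using ln_square_sum_nonneg by (simp_all add: stein_const_def mertens_const_def)
  have A: "A > 0" using pos by (simp add: A_def)
  obtain n1 where n1: "\<And>m. m \<ge> n1 \<Longrightarrow> prime_weight m \<le> ln m - 0.01"
    using eventually_prime_weight_le unfolding eventually_sequentially by blast
  show ?thesis
  proof (rule exI[of _ C], rule exI[of _ c], rule exI[of _ "max 3 n1"], intro conjI allI impI)
    show "c > 0" using A by (simp add: c_def)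
  next
    fix M :: "'a measure" and X and N :: "'b measure" and D n
    assume X: "indep_prime_geometric M X" and D: "standard_dickman N D" and n2: "2 \<le> (n::nat)"
    interpret dickman_approx M X n "distr N borel D"
      by unfold_locales (use X D n2 in \<open>auto simp: standard_dickman_def\<close>)
    \<comment> \<open>The bounds are in terms of \<open>L = ln p\<^sub>n\<close>, which lies between \<open>ln n\<close> and a multiple of \<open>ln n\<close>.\<close>
    have "ln (real n) \<le> L"
      unfolding L_def using nth_prime_gt[of n] n2 by (subst ln_le_cancel_iff) auto
    hence "C / L \<le> C / ln (real n)"
      using n2 pos L_pos by (intro divide_left_mono) (auto simp: C_def)
    thus "d11 (distr M borel S) (distr N borel D) \<le> ereal (C / ln (real n))"
      using d11_le unfolding C_def by (meson ereal_less_eq(3) order_trans)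
  next
    fix M :: "'a measure" and X and N :: "'b measure" and D n
    assume X: "indep_prime_geometric M X" and D: "standard_dickman N D" and n2: "max 3 n1 \<le> (n::nat)"
    interpret dickman_approx M X n "distr N borel D"
      by unfold_locales (use X D n2 in \<open>auto simp: standard_dickman_def\<close>)
    have "nth_prime n \<ge> n1" using nth_prime_gt[of n] n2 by simp
    hence w: "0.01 \<le> L - prime_weight (nth_prime n)" using n1[of "nth_prime n"] unfolding L_def by linarith
    have "ln (real n) \<ge> 1"
    proof -
      have "exp 1 \<le> real n" using exp_le n2 by linarith
      thus ?thesis using n2 by (subst ln_ge_iff) auto
    qed
    hence "(2 * mertens_const + 2) * 1 \<le> (2 * mertens_const + 2) * ln (real n)"
      using pos by (intro mult_left_mono) auto
    hence "L \<le> A * ln (real n)"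
      using ln_nth_prime_le[of n] n2 unfolding L_def A_def by (simp add: algebra_simps)
    hence "0.01 / (A * ln (real n)) \<le> 0.01 / L"
      using L_pos A \<open>ln (real n) \<ge> 1\<close> by (intro divide_left_mono) auto
    also have "\<dots> \<le> (L - prime_weight (nth_prime n)) / L"
      using w L_pos by (intro divide_right_mono) auto
    finally have "c / ln (real n) \<le> (L - prime_weight (nth_prime n)) / L" by (simp add: c_def)
    thus "d11 (distr M borel S) (distr N borel D) \<ge> ereal (c / ln (real n))"
      using d11_ge by (meson ereal_less_eq(3) order_trans)
  qed
qed

end
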